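(* The following equalities hold: 1. $d_{\mathrm{GH}}^{\mathbb Z_2}(\mathbb S^1_{\mathrm E},\mathbb S^2_{\mathrm E})=\frac{\sqrt3}{2}$; 2. $d_{\mathrm{GH}}^{\mathbb Z_2}(\mathbb S^1_{\mathrm E},\mathbb S^3_{\mathrm E})=\frac{\sqrt3}{2}$; 3. $d_{\mathrm{GH}}^{\mathbb Z_2}(\mathbb S^2_{\mathrm E},\mathbb S^3_{\mathrm E})=\sqrt{\frac23}$.
   Context: $\mathbb S^n_{\mathrm E}$ is the unit sphere in $\mathbb R^{n+1}$ with the Euclidean metric $\|u-v\|$ inherited from $\mathbb R^{n+1}$ and the antipodal $\mathbb Z_2$-action $u\mapsto-u$. For metric spaces $X,Y$ with isometric $\mathbb Z_2$-actions generated by involutions $\tau_X,\tau_Y$, $d_{\mathrm{GH}}^{\mathbb Z_2}(X,Y):=\frac12\inf_R\sup_{(x,y),(x',y')\in R}|d_X(x,x')-d_Y(y,y')|$, the infimum over all sets $R\subseteq X\times Y$ projecting onto $X$ and onto $Y$ such that $(\tau_X(x),\tau_Y(y))\in R$ whenever $(x,y)\in R$. *)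

theory Defs
  imports "HOL-Analysis.Analysis"
begin

text \<open>A metric space is a set \<open>X\<close> in a type of class \<^class>\<open>metric_space\<close> with the metric
  inherited from that type; an isometric \<open>\<int>\<^sub>2\<close>-action on it is given by its generator.\<close>

definition isometric_involution_on ::
    "'a::metric_space set \<Rightarrow> ('a \<Rightarrow> 'a) \<Rightarrow> bool" where
  "isometric_involution_on X \<tau> \<longleftrightarrow>
     (\<forall>x\<in>X. \<tau> x \<in> X \<and> \<tau> (\<tau> x) = x) \<and> (\<forall>x\<in>X. \<forall>x'\<in>X. dist (\<tau> x) (\<tau> x') = dist x x')"

definition Z2_correspondence ::
    "'a set \<Rightarrow> ('a \<Rightarrow> 'a) \<Rightarrow> 'b set \<Rightarrow> ('b \<Rightarrow> 'b) \<Rightarrow> ('a \<times> 'b) set \<Rightarrow> bool" where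
  "Z2_correspondence X \<tau>\<^sub>X Y \<tau>\<^sub>Y R \<longleftrightarrow>
     R \<subseteq> X \<times> Y \<and> fst ` R = X \<and> snd ` R = Y \<and> (\<forall>(x, y)\<in>R. (\<tau>\<^sub>X x, \<tau>\<^sub>Y y) \<in> R)"

text \<open>Suprema and infima are taken in \<^typ>\<open>ennreal\<close>, where they have their usual meaning also for
  unbounded spaces (real-valued \<open>Sup\<close> and \<open>Inf\<close> are unspecified there).\<close>

definition distortion :: "('a::metric_space \<times> 'b::metric_space) set \<Rightarrow> ennreal" where
  "distortion R =
     (SUP ((x, y), (x', y')) \<in> R \<times> R. ennreal \<bar>dist x x' - dist y y'\<bar>)"

definition dGH_Z2 ::
    "'a::metric_space set \<Rightarrow> ('a \<Rightarrow> 'a) \<Rightarrow> 'b::metric_space set \<Rightarrow> ('b \<Rightarrow> 'b) \<Rightarrow> ennreal" where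
  "dGH_Z2 X \<tau>\<^sub>X Y \<tau>\<^sub>Y =
     (INF R \<in> {R. Z2_correspondence X \<tau>\<^sub>X Y \<tau>\<^sub>Y R}. distortion R) / 2"

lemma isometric_involution_on_sphere:
  "isometric_involution_on (sphere (0::'a::real_normed_vector) 1) uminus"
  by (simp add: isometric_involution_on_def dist_norm norm_minus_commute)

end

theory Submission
  imports Defs "HOL-Homology.Invariance_of_Domain"
begin

text \<open>
  Write \<open>s = sqrt (2 + 2 / d)\<close> for the side of the regular simplex inscribed in the unit sphere of a
  \<open>d\<close>-dimensional space, so that \<open>s / 2\<close> is \<open>sqrt 3 / 2\<close> for the circle (\<open>d = 2\<close>) and \<open>sqrt (2 / 3)\<close> for
  the two-sphere (\<open>d = 3\<close>). In all three cases \<open>s\<close> is the least possible distortion, where \<open>d - 1\<close> is the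
  dimension of the smaller sphere.

  Lower bound. Let a \<open>\<int>\<^sub>2\<close>-correspondence have distortion less than \<open>s\<close>. Averaging the points that
  correspond to the members of a fine antipodally symmetric net near \<open>y\<close> gives a continuous odd map from
  the large sphere to the Euclidean space around the small one. The points averaged at \<open>y\<close> have mutual
  distances less than \<open>s\<close>, and unit vectors whose convex hull contains \<open>0\<close> include two at distance
  at least \<open>s\<close> (lemma \<open>obtuse_pair_of_convex_hull\<close>, by Caratheodory's theorem); hence the
  map has no zero. This contradicts the Borsuk--Ulam theorem (\<open>Borsuk_Ulam\<close>).

  The Borsuk--Ulam theorem follows from the fact that an odd self-map of a sphere that preserves the
  equator has the same degree modulo two as its restriction to the equator. An odd
  zero-free map into a space of smaller dimension may be taken polynomial; then the directions of its values on a
  coordinate subsphere omit a pair of antipodes of the next one, and reflections and rescalings of single coordinates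
  make the map preserve a whole flag of coordinate subspheres (\<open>odd_flag_map_step\<close>). Down
  the flag all degrees have the parity of the degree on the zero-sphere, which is odd; but on the largest
  subsphere the map extends over a hemisphere, so its degree is zero.

  Upper bound. Let \<open>\<zeta>\<close> be the angle with \<open>2 sin (\<zeta> / 2) = s\<close>, that is \<open>2 \<pi> / 3\<close> or \<open>arccos (- 1 / 3)\<close>. By
  concavity of the chord as a function of the angle, and because a \<open>\<int>\<^sub>2\<close>-correspondence may be composed
  with the antipode, it suffices that related pairs satisfy
  \<open>angle of (y, y') \<le> angle of (x, x') + \<zeta>\<close> (\<open>dGH_Z2_sphere_le\<close>).

  For the circle and the three-sphere in \<open>\<complex> \<times> \<complex>\<close>, relate \<open>u\<close> to \<open>(z, w)\<close> when \<open>w\<close> is a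
  nonnegative multiple of \<open>u\<^sup>3\<close> and \<open>z\<close> is zero or lies within \<open>\<pi> / 3\<close> of \<open>u\<close>. If \<open>u\<close> and \<open>u'\<close> make an angle
  \<open>\<delta> \<le> \<pi> / 3\<close>, then \<open>z\<close> and \<open>z'\<close> make at most the angle \<open>\<delta> + 2 \<pi> / 3\<close>, and \<open>w\<close> and \<open>w'\<close> make
  \<open>3 \<delta> \<le> \<delta> + 2 \<pi> / 3\<close>; the combined angle obeys the same bound. Real \<open>w\<close> give the two-sphere.

  For the two-sphere and the three-sphere, consider a point \<open>(y, t)\<close> with height \<open>t \<ge> 0\<close>. Near the
  equator it is related to its projection \<open>y / |y|\<close>; near the pole it is related to the vertices \<open>u\<close> of a
  regular tetrahedron for which \<open>y\<close> lies in the cone around \<open>u\<close>. The lower hemisphere is handled by the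
  antipode. The height at which the rule changes must depend on \<open>y\<close>, since two conditions compete: points
  related to one vertex must not be further apart than \<open>\<zeta>\<close>, which near the coordinate axes fails for
  small heights, and arbitrarily close to the pole there are points related to each of the four vertices,
  so a point related to the direction opposite to a vertex has height at most \<open>1 / 3\<close>. The height
  \<open>1 / 2\<close> near the coordinate axes and \<open>1 / 3\<close> elsewhere meets both.
\<close>

section \<open>Odd self-maps of spheres that preserve a flag\<close>

lemma nsphere_subsphere:
  assumes "k \<le> n"
  shows "subtopology (nsphere n) (topspace (nsphere k)) = nsphere k"
proof -
  have "(\<Sum>i\<le>n. (x i)\<^sup>2) = (\<Sum>i\<le>k. (x i)\<^sup>2)" if "\<forall>i>k. x i = 0" for x :: "nat \<Rightarrow> real"
    by (rule sum.mono_neutral_right) (use assms that in auto)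
  then have "{x. (\<Sum>i\<le>n. (x i)\<^sup>2) = 1 \<and> (\<forall>i>n. x i = 0)} \<inter> {x. (\<Sum>i\<le>k. (x i)\<^sup>2) = 1 \<and> (\<forall>i>k. x i = 0)}
      = {x. (\<Sum>i\<le>k. (x i)\<^sup>2) = 1 \<and> (\<forall>i>k. x i = (0::real))}"
    using assms by auto
  then show ?thesis
    by (simp add: nsphere subtopology_subtopology)
qed

lemma topspace_nsphere: "topspace (nsphere n) = {x. (\<Sum>i\<le>n. (x i)\<^sup>2) = 1 \<and> (\<forall>i>n. x i = 0)}"
  by (simp add: nsphere)

lemma topspace_nsphere_mono: "k \<le> n \<Longrightarrow> topspace (nsphere k) \<subseteq> topspace (nsphere n)"
  using nsphere_subsphere[of k n] by (metis inf_le1 topspace_subtopology)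

lemma topspace_nsphere_0:
  "topspace (nsphere 0) = {(\<lambda>i. if i = 0 then 1 else 0), (\<lambda>i. if i = 0 then -1 else 0)}"
  by (auto simp: nsphere fun_eq_iff power2_eq_1_iff split: if_split_asm)

text \<open>An odd self-map of the two points of the zero-sphere is the identity or the reflection.\<close>

lemma Brouwer_degree2_odd_nsphere_0:
  assumes "f \<in> topspace (nsphere 0) \<rightarrow> topspace (nsphere 0)"
    and odd: "\<And>x. x \<in> topspace (nsphere 0) \<Longrightarrow> f (\<lambda>i. - x i) = (\<lambda>i. - f x i)"
  shows "odd (Brouwer_degree2 0 f)"
proof -
  define p :: "nat \<Rightarrow> real" where "p = (\<lambda>i. if i = 0 then 1 else 0)"
  define n :: "nat \<Rightarrow> real" where "n = (\<lambda>i. if i = 0 then -1 else 0)"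
  have top: "topspace (nsphere 0) = {p, n}"
    by (simp add: topspace_nsphere_0 p_def n_def)
  have np: "(\<lambda>i. - p i) = n" "(\<lambda>i. - n i) = p"
    by (auto simp: p_def n_def)
  have neg0: "(\<lambda>i. if i = 0 then - p i else p i) = n" "(\<lambda>i. if i = 0 then - n i else n i) = p"
    by (auto simp: p_def n_def)
  have fn: "f n = (\<lambda>i. - f p i)"
    using odd[of p] by (simp add: top np)
  consider "f p = p" | "f p = n"
    using assms(1) by (auto simp: top)
  then show ?thesis
  proof cases
    case 1
    then have "Brouwer_degree2 0 f = Brouwer_degree2 0 id"
      using fn by (intro Brouwer_degree2_eq) (auto simp: top np)
    then show ?thesis by simp
  next
    case 2
    then have "Brouwer_degree2 0 f = Brouwer_degree2 0 (\<lambda>x i. if i = 0 then - x i else x i)"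
      using fn np neg0 by (intro Brouwer_degree2_eq) (auto simp: top)
    then show ?thesis by (simp add: Brouwer_degree2_reflection)
  qed
qed

text \<open>Two computations of the degree on \<open>nsphere n\<close> disagree. Restricting step by step to the equators
  shows that it is odd, since it is odd on the zero-sphere and each step keeps its parity. But \<open>f\<close> is defined on
  the upper hemisphere of the next sphere as well, which is contractible, and so the degree is zero.\<close>

lemma no_odd_flag_map_nsphere:
  assumes cont: "continuous_map (nsphere (Suc n)) (nsphere n) f"
    and odd: "\<And>x. x \<in> topspace (nsphere (Suc n)) \<Longrightarrow> f (\<lambda>i. - x i) = (\<lambda>i. - f x i)"
    and flag: "\<And>k. k \<le> n \<Longrightarrow> f \<in> topspace (nsphere k) \<rightarrow> topspace (nsphere k)"
  shows False
proof -
  have cont_k: "continuous_map (nsphere k) (nsphere k) f" if "k \<le> n" for k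
  proof -
    have "continuous_map (subtopology (nsphere (Suc n)) (topspace (nsphere k)))
        (subtopology (nsphere n) (topspace (nsphere k))) f"
      using cont flag[OF that] that topspace_nsphere_mono[of k "Suc n"]
      by (auto simp: continuous_map_in_subtopology continuous_map_from_subtopology)
    then show ?thesis
      using that by (simp add: nsphere_subsphere)
  qed
  have "odd (Brouwer_degree2 k f)" if "k \<le> n" for k
    using that
  proof (induction k)
    case 0
    then show ?case
      using flag[of 0] odd topspace_nsphere_mono[of 0 "Suc n"]
      by (intro Brouwer_degree2_odd_nsphere_0) auto
  next
    case (Suc k)
    have "even (Brouwer_degree2 (Suc k) f - Brouwer_degree2 (Suc k - Suc 0) f)"
      using cont_k[of "Suc k"] odd flag[of k] Suc.prems topspace_nsphere_mono[of "Suc k" "Suc n"]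
      by (intro Borsuk_odd_mapping_degree_step) auto
    then show ?case
      using Suc by auto
  qed
  moreover have "Brouwer_degree2 n f = 0"
  proof -
    let ?H = "subtopology (nsphere (Suc n)) {x. x (Suc n) \<ge> 0}"
    have "continuous_map (subtopology (nsphere (Suc n)) {x. x (Suc n) = 0}) ?H id"
      by (auto simp: continuous_map_in_subtopology continuous_map_from_subtopology)
    then have "continuous_map (nsphere n) ?H id"
      by (simp add: subtopology_nsphere_equator)
    moreover have "continuous_map ?H (nsphere n) f"
      using cont continuous_map_from_subtopology by blast
    moreover have "contractible_space ?H"
      by (rule contractible_space_upper_hemisphere) simp
    ultimately obtain c where "homotopic_with (\<lambda>h. True) (nsphere n) (nsphere n) (f \<circ> id) (\<lambda>x. c)"
      by (rule nullhomotopic_through_contractible_space)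
    then show ?thesis
      using Brouwer_degree2_nullhomotopic by simp
  qed
  ultimately show False
    by force
qed

section \<open>The Borsuk--Ulam theorem\<close>

text \<open>The reflection in the hyperplane orthogonal to \<open>h\<close>. For \<open>h = 0\<close> the division by zero
  makes it the identity, so that \<open>reflect_diff\<close> covers the case \<open>q = p\<close>.\<close>

definition reflect :: "'a::euclidean_space \<Rightarrow> 'a \<Rightarrow> 'a" where
  "reflect h v = v - (2 * (v \<bullet> h) / (h \<bullet> h)) *\<^sub>R h"

lemma linear_reflect: "linear (reflect h)"
  by (rule linearI) (auto simp: reflect_def inner_add_left algebra_simps add_divide_distrib)

lemma reflect_reflect: "reflect h (reflect h v) = v"
  by (cases "h = 0") (auto simp: reflect_def inner_diff_left algebra_simps)

lemma reflect_diff: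
  assumes "norm q = norm p" shows "reflect (q - p) q = p"
proof (cases "q = p")
  case False
  have "q \<bullet> q = p \<bullet> p"
    using assms by (simp add: dot_square_norm)
  then have eq: "(q - p) \<bullet> (q - p) = 2 * (q \<bullet> (q - p))"
    by (simp add: inner_diff_left inner_diff_right inner_commute)
  have "2 * (q \<bullet> (q - p)) / ((q - p) \<bullet> (q - p)) = 1"
    unfolding eq[symmetric] using False by simp
  then show ?thesis
    unfolding reflect_def by (simp only: scaleR_one) simp
qed (simp add: reflect_def)

text \<open>Normalising a polynomial map keeps it differentiable, and a differentiable map cannot send a sphere onto one of
  larger dimension. If the unit vector \<open>q\<close> is omitted, then by oddness so is \<open>- q\<close>, and with it the
  whole line through \<open>q\<close>.\<close>

lemma polynomial_omits_direction:
  fixes g :: "'a::euclidean_space \<Rightarrow> 'a"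
  assumes S: "subspace S" and T: "subspace T" and "S \<subseteq> T" "dim S < dim T"
    and g: "polynomial_function g"
    and gT: "\<And>x. x \<in> sphere 0 1 \<inter> S \<Longrightarrow> g x \<in> T"
    and nz: "\<And>x. x \<in> sphere 0 1 \<inter> S \<Longrightarrow> g x \<noteq> 0"
    and odd: "\<And>x. g (- x) = - g x"
  obtains q where "q \<in> T" "norm q = 1" "\<And>x. x \<in> sphere 0 1 \<inter> S \<Longrightarrow> g x \<notin> span {q}"
proof -
  define u where "u = (\<lambda>x. inverse (norm (g x)) *\<^sub>R g x)"
  have "(\<lambda>x. inverse (norm (g x)) *\<^sub>R g x) differentiable_on sphere 0 1 \<inter> S"
    unfolding differentiable_on_def
  proof (intro ballI derivative_intros)
    fix x assume x: "x \<in> sphere 0 1 \<inter> S"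
    show dg: "g differentiable at x within sphere 0 1 \<inter> S"
      by (rule differentiable_at_polynomial_function[OF g])
    show "(\<lambda>x. norm (g x)) differentiable at x within sphere 0 1 \<inter> S"
      by (rule differentiable_compose[OF _ dg]) (use nz[OF x] in simp)
    show "norm (g x) \<noteq> 0" using nz[OF x] by simp
  qed
  then have "u ` (sphere 0 1 \<inter> S) \<noteq> sphere 0 1 \<inter> T"
    unfolding u_def by (intro spheremap_lemma1 assms)
  moreover have "u ` (sphere 0 1 \<inter> S) \<subseteq> sphere 0 1 \<inter> T"
    using gT nz T by (auto simp: u_def subspace_mul)
  ultimately obtain q where q: "q \<in> T" "norm q = 1" "q \<notin> u ` (sphere 0 1 \<inter> S)"
    by (auto simp: set_eq_iff subset_iff)
  have "g x \<notin> span {q}" if x: "x \<in> sphere 0 1 \<inter> S" for x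
  proof
    assume "g x \<in> span {q}"
    then obtain c where c: "g x = c *\<^sub>R q"
      by (auto simp: span_singleton)
    with nz[OF x] have "c \<noteq> 0" by auto
    define y where "y = (if c > 0 then x else - x)"
    have y: "y \<in> sphere 0 1 \<inter> S"
      using x S by (auto simp: y_def subspace_neg)
    have "u y = q"
      using \<open>c \<noteq> 0\<close> odd c q(2) by (auto simp: u_def y_def)
    then show False
      using y q(3) by blast
  qed
  then show ?thesis
    using that q by blast
qed

text \<open>An enumeration of the standard basis gives the coordinates, and hence the chain of coordinate subspaces, along
  which degrees are compared.\<close>

locale enumerated_basis =
  fixes b :: "nat \<Rightarrow> 'a::euclidean_space"
  assumes bij: "bij_betw b {..<DIM('a)} Basis"
begin

definition flag :: "nat \<Rightarrow> 'a set" where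
  "flag j = {v. \<forall>i\<in>{j..<DIM('a)}. v \<bullet> b i = 0}"

lemma b_in_Basis: "i < DIM('a) \<Longrightarrow> b i \<in> Basis"
  using bij_betwE[OF bij] by simp

lemma Basis_obtain:
  assumes "e \<in> Basis" obtains i where "i < DIM('a)" "e = b i"
  using assms bij_betw_imp_surj_on[OF bij] by blast

lemma b_eq_iff: "i < DIM('a) \<Longrightarrow> j < DIM('a) \<Longrightarrow> b i = b j \<longleftrightarrow> i = j"
  using bij by (auto simp: bij_betw_def inj_on_def)

lemma inner_b_b: "i < DIM('a) \<Longrightarrow> j < DIM('a) \<Longrightarrow> b i \<bullet> b j = (if i = j then 1 else 0)"
  by (simp add: b_in_Basis inner_Basis b_eq_iff)

lemma norm_b: "i < DIM('a) \<Longrightarrow> norm (b i) = 1"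
  by (simp add: b_in_Basis)

lemma eq_0_iff_coords: "v = 0 \<longleftrightarrow> (\<forall>i<DIM('a). v \<bullet> b i = 0)"
proof
  assume "\<forall>i<DIM('a). v \<bullet> b i = 0"
  then have "\<forall>e\<in>Basis. v \<bullet> e = 0"
    by (metis Basis_obtain)
  then show "v = 0"
    by (simp add: euclidean_all_zero_iff)
qed auto

lemma subspace_flag: "subspace (flag j)"
  by (auto simp: subspace_def flag_def inner_add_left)

lemma flag_mono: "i \<le> j \<Longrightarrow> flag i \<subseteq> flag j"
  by (auto simp: flag_def)

lemma b_in_flag: "i < j \<Longrightarrow> j \<le> DIM('a) \<Longrightarrow> b i \<in> flag j"
  by (auto simp: flag_def inner_b_b)

lemma flag_Suc_iff: "j < DIM('a) \<Longrightarrow> v \<in> flag j \<longleftrightarrow> v \<in> flag (Suc j) \<and> v \<bullet> b j = 0"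
  by (auto simp: flag_def Suc_le_eq le_less)

lemma dim_flag:
  assumes "j \<le> DIM('a)" shows "dim (flag j) = j"
proof -
  have "flag j = {v. \<forall>e\<in>Basis. e \<notin> b ` {..<j} \<longrightarrow> v \<bullet> e = 0}"
  proof -
    have "b i \<in> b ` {..<j} \<longleftrightarrow> i < j" if "i < DIM('a)" for i
    proof
      assume "b i \<in> b ` {..<j}"
      then obtain k where "k < j" "b i = b k" by auto
      then show "i < j" using b_eq_iff[of i k] assms that by simp
    qed simp
    then show ?thesis
      unfolding flag_def by (smt (verit) Basis_obtain Collect_cong atLeastLessThan_iff b_in_Basis not_less)
  qed
  moreover have "b ` {..<j} \<subseteq> Basis"
    using assms b_in_Basis by auto
  moreover have "card (b ` {..<j}) = j"
    using b_eq_iff assms by (subst card_image) (auto simp: inj_on_def)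
  ultimately show ?thesis
    by (simp add: dim_substandard)
qed

lemma not_in_flag_norm:
  assumes "j \<le> DIM('a)" "x \<notin> flag j" shows "(\<Sum>i\<in>{j..<DIM('a)}. (x \<bullet> b i)\<^sup>2) > 0"
proof -
  obtain i where "i \<in> {j..<DIM('a)}" "x \<bullet> b i \<noteq> 0"
    using assms by (auto simp: flag_def)
  then show ?thesis
    by (intro sum_pos2[of _ i]) auto
qed

lemma flag_sum0:
  assumes "x \<in> flag j" shows "(\<Sum>i\<in>{j..<DIM('a)}. (x \<bullet> b i)\<^sup>2) = 0"
  using assms by (auto simp: flag_def)

lemma reflect_in_flag: "h \<in> flag j \<Longrightarrow> v \<in> flag j \<Longrightarrow> reflect h v \<in> flag j"
  by (simp add: reflect_def subspace_flag subspace_diff subspace_mul)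

text \<open>The member \<open>j = DIM('a)\<close> of the flag is the whole space; the condition that the values lie in
  \<open>flag (DIM('a) - 1)\<close> replaces it and says that the map lowers the dimension.\<close>

definition odd_flag_map :: "nat \<Rightarrow> ('a \<Rightarrow> 'a) \<Rightarrow> bool" where
  "odd_flag_map m g \<longleftrightarrow> polynomial_function g \<and> (\<forall>x. g (- x) = - g x) \<and> (\<forall>x\<in>sphere 0 1. g x \<noteq> 0)
      \<and> (\<forall>x\<in>sphere 0 1. g x \<in> flag (DIM('a) - 1))
      \<and> (\<forall>j x. m \<le> j \<longrightarrow> j < DIM('a) \<longrightarrow> x \<in> sphere 0 1 \<inter> flag j \<longrightarrow> g x \<in> flag j)"

text \<open>On \<open>flag m\<close> the map takes values in \<open>flag (Suc m)\<close>, where it omits a line. A reflection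
  moves that line to the \<open>m\<close>-th axis. Multiplying the \<open>m\<close>-th coordinate of the values by the
  squared distance \<open>c\<close> from \<open>flag m\<close> then forces \<open>flag m\<close> into itself. No zero arises:
  off \<open>flag m\<close> the factor is positive, and on it some other coordinate of the value is nonzero because the axis
  was omitted. The reflection maps the larger members of the flag to themselves, and the result is again polynomial, so that
  the step can be repeated.\<close>

lemma odd_flag_map_step:
  assumes m: "Suc m < DIM('a)" and "odd_flag_map (Suc m) g"
  shows "\<exists>g'. odd_flag_map m g'"
proof -
  have g: "polynomial_function g" and odd: "\<And>x. g (- x) = - g x"
    and nz: "\<And>x. x \<in> sphere 0 1 \<Longrightarrow> g x \<noteq> 0"
    and range: "\<And>x. x \<in> sphere 0 1 \<Longrightarrow> g x \<in> flag (DIM('a) - 1)"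
    and flag: "\<And>j x. \<lbrakk>Suc m \<le> j; j < DIM('a); x \<in> sphere 0 1 \<inter> flag j\<rbrakk> \<Longrightarrow> g x \<in> flag j"
    using assms(2) by (auto simp: odd_flag_map_def)
  have sub: "flag m \<subseteq> flag (Suc m)" by (simp add: flag_mono)
  obtain q where q: "q \<in> flag (Suc m)" "norm q = 1"
      "\<And>x. x \<in> sphere 0 1 \<inter> flag m \<Longrightarrow> g x \<notin> span {q}"
  proof (rule polynomial_omits_direction[of "flag m" "flag (Suc m)" g])
    show "dim (flag m) < dim (flag (Suc m))"
      using m by (simp add: dim_flag)
  qed (use m g odd nz flag sub subspace_flag in auto)
  define h where "h = q - b m"
  have h: "h \<in> flag j" if "Suc m \<le> j" "j \<le> DIM('a)" for j
    using that q(1) flag_mono[of "Suc m" j] b_in_flag[of m j] m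
    by (auto simp: h_def subspace_flag intro: subspace_diff)
  define G where "G = (\<lambda>x. reflect h (g x))"
  have polyG: "polynomial_function G"
    using polynomial_function_compose[OF g polynomial_function_bounded_linear[of "reflect h"]]
    using linear_reflect[of h] by (simp add: G_def o_def linear_conv_bounded_linear)
  have oddG: "G (- x) = - G x" for x
    by (simp add: G_def odd linear_neg linear_reflect)
  have nzG: "G x \<noteq> 0" if "x \<in> sphere 0 1" for x
    using nz[OF that] reflect_reflect[of h "g x"] linear_0[OF linear_reflect, of h] by (auto simp: G_def)
  have G_omits: "G x \<noteq> c *\<^sub>R b m" if "x \<in> sphere 0 1 \<inter> flag m" for x c
  proof
    assume "G x = c *\<^sub>R b m"
    also have "b m = reflect h q"
      using q(2) m by (simp add: h_def reflect_diff norm_b)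
    also have "c *\<^sub>R reflect h q = reflect h (c *\<^sub>R q)"
      by (simp add: linear_scale linear_reflect)
    finally have "g x = c *\<^sub>R q"
      unfolding G_def by (metis reflect_reflect)
    then show False
      using q(3)[OF that] by (simp add: span_mul span_base)
  qed
  define c where "c = (\<lambda>x::'a. \<Sum>i\<in>{m..<DIM('a)}. (x \<bullet> b i)\<^sup>2)"
  define g' where "g' = (\<lambda>x. G x - ((1 - c x) * (G x \<bullet> b m)) *\<^sub>R b m)"
  have g'_m: "g' x \<bullet> b m = c x * (G x \<bullet> b m)" for x
    using m by (simp add: g'_def inner_diff_left inner_b_b algebra_simps)
  have g'_i: "g' x \<bullet> b i = G x \<bullet> b i" if "i < DIM('a)" "i \<noteq> m" for x i
    using m that by (simp add: g'_def inner_diff_left inner_b_b)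
  have flag_g': "g' x \<in> flag j" if "G x \<in> flag j" "Suc m \<le> j" for j x
    using that g'_i by (auto simp: flag_def)
  have "odd_flag_map m g'"
    unfolding odd_flag_map_def
  proof (intro conjI allI ballI impI)
    have "real_polynomial_function c"
      unfolding c_def
      by (intro real_polynomial_function_sum real_polynomial_function_power real_polynomial_function.intros(1)
          bounded_linear_inner_left) auto
    then have "polynomial_function c"
      by (simp add: real_polynomial_function_eq)
    then show "polynomial_function g'"
      unfolding g'_def using polyG
      by (intro polynomial_function_diff polynomial_function_inner polynomial_function_const
          polynomial_function_mult[of _ "\<lambda>x. G x \<bullet> b m", unfolded real_scaleR_def]
          polynomial_function_mult[of _ "\<lambda>x. b m"])
    show "g' (- x) = - g' x" for x
      by (simp add: g'_def oddG c_def)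
    show "g' x \<noteq> 0" if x: "x \<in> sphere 0 1" for x
    proof
      assume g'0: "g' x = 0"
      have Gi: "G x \<bullet> b i = 0" if "i < DIM('a)" "i \<noteq> m" for i
        using g'_i[OF that, of x] g'0 by simp
      show False
      proof (cases "x \<in> flag m")
        case True
        have "G x - (G x \<bullet> b m) *\<^sub>R b m = 0"
          using Gi m unfolding eq_0_iff_coords[of "G x - _"] by (auto simp: inner_diff_left inner_b_b)
        then show False
          using G_omits[of x "G x \<bullet> b m"] True x by simp
      next
        case False
        then have "c x > 0"
          unfolding c_def using m by (intro not_in_flag_norm) auto
        then have "G x \<bullet> b m = 0"
          using g'_m[of x] g'0 by simp
        then have "G x = 0"
          using Gi by (auto simp: eq_0_iff_coords)
        then show False using nzG x by blast
      qed
    qed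
    show "g' x \<in> flag (DIM('a) - 1)" if x: "x \<in> sphere 0 1" for x
      using range[OF x] h[of "DIM('a) - 1"] m by (intro flag_g') (auto simp: G_def reflect_in_flag)
    fix j x assume j: "m \<le> j" "j < DIM('a)" and x: "x \<in> sphere 0 1 \<inter> flag j"
    show "g' x \<in> flag j"
    proof -
      have *: "g' x \<in> flag j" if "Suc m \<le> j" "j < DIM('a)" "x \<in> sphere 0 1 \<inter> flag j" for j
        using flag[OF that] h[of j] that by (intro flag_g') (auto simp: G_def reflect_in_flag)
      show ?thesis
      proof (cases "j = m")
        case True
        have "c x = 0"
          using x True unfolding c_def by (intro flag_sum0) auto
        then have "g' x \<bullet> b m = 0" by (simp add: g'_m)
        moreover have "g' x \<in> flag (Suc m)"
          using *[of "Suc m"] m x True sub by auto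
        ultimately show ?thesis
          using True m by (simp add: flag_Suc_iff)
      next
        case False
        then show ?thesis using * j x by auto
      qed
    qed
  qed
  then show ?thesis by blast
qed

lemma odd_flag_map_exists:
  fixes g :: "'a \<Rightarrow> 'a"
  assumes "polynomial_function g" "\<And>x. g (- x) = - g x"
    and "\<And>x. x \<in> sphere 0 1 \<Longrightarrow> g x \<noteq> 0"
    and "\<And>x. x \<in> sphere 0 1 \<Longrightarrow> g x \<in> flag (DIM('a) - 1)"
  shows "\<exists>g'. odd_flag_map 0 g'"
proof -
  have "\<exists>g. odd_flag_map m g" if "m \<le> DIM('a) - 1" for m
    using that
  proof (induction m rule: inc_induct)
    case base
    have "j = DIM('a) - 1" if "DIM('a) - 1 \<le> j" "j < DIM('a)" for j
      using that by linarith
    then have "odd_flag_map (DIM('a) - 1) g"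
      unfolding odd_flag_map_def using assms by blast
    then show ?case by blast
  next
    case (step m)
    then have "Suc m < DIM('a)" by simp
    with step.IH show ?case
      using odd_flag_map_step by blast
  qed
  then show ?thesis by blast
qed

text \<open>Coordinates with respect to \<open>b\<close> turn the normalised map into a map between the spheres
  \<open>nsphere\<close>, to which \<open>no_odd_flag_map_nsphere\<close> applies.\<close>

lemma no_odd_map_into_flag:
  fixes g :: "'a \<Rightarrow> 'a"
  assumes dim: "2 \<le> DIM('a)"
    and cont: "continuous_on (sphere 0 1) g" and odd: "\<And>x. x \<in> sphere 0 1 \<Longrightarrow> g (- x) = - g x"
    and range: "\<And>x. x \<in> sphere 0 1 \<Longrightarrow> g x \<in> flag (DIM('a) - 1)"
    and flag: "\<And>j x. \<lbrakk>j < DIM('a); x \<in> sphere 0 1 \<inter> flag j\<rbrakk> \<Longrightarrow> g x \<in> flag j"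
  shows "\<exists>x\<in>sphere 0 1. g x = 0"
proof (rule ccontr)
  assume "\<not> ?thesis"
  then have nz: "g x \<noteq> 0" if "x \<in> sphere 0 1" for x
    using that by blast
  define n where "n = DIM('a) - 2"
  have DIM: "DIM('a) = Suc (Suc n)"
    using dim by (simp add: n_def)
  define vec where "vec = (\<lambda>x::nat \<Rightarrow> real. \<Sum>i<DIM('a). x i *\<^sub>R b i)"
  have vec_b: "vec x \<bullet> b i = x i" if "i < DIM('a)" for x i
  proof -
    have "vec x \<bullet> b i = (\<Sum>k<DIM('a). if k = i then x k else 0)"
      unfolding vec_def inner_sum_left using that by (intro sum.cong) (auto simp: inner_b_b)
    then show ?thesis using that by simp
  qed
  have norm_coords: "(norm v)\<^sup>2 = (\<Sum>i<DIM('a). (v \<bullet> b i)\<^sup>2)" for v :: 'a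
  proof -
    have "(norm v)\<^sup>2 = (\<Sum>e\<in>Basis. (v \<bullet> e)\<^sup>2)"
      unfolding power2_norm_eq_inner by (subst euclidean_inner) (simp add: power2_eq_square)
    also have "\<dots> = (\<Sum>i<DIM('a). (v \<bullet> b i)\<^sup>2)"
      by (rule sum.reindex_bij_betw[OF bij, symmetric])
    finally show ?thesis .
  qed
  have vec_flag: "vec x \<in> sphere 0 1 \<inter> flag (Suc k)" if "x \<in> topspace (nsphere k)" "k \<le> Suc n" for x k
  proof -
    have "(norm (vec x))\<^sup>2 = (\<Sum>i<DIM('a). (x i)\<^sup>2)"
      unfolding norm_coords by (simp add: vec_b)
    also have "\<dots> = (\<Sum>i\<le>k. (x i)\<^sup>2)"
      using that by (intro sum.mono_neutral_right) (auto simp: topspace_nsphere DIM)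
    also have "\<dots> = 1"
      using that by (simp add: topspace_nsphere)
    finally have "norm (vec x) = 1"
      by (simp add: power2_eq_1_iff) (metis norm_ge_zero not_one_le_zero neg_0_le_iff_le)
    moreover have "vec x \<in> flag (Suc k)"
      using that by (auto simp: flag_def vec_b topspace_nsphere)
    ultimately show ?thesis by simp
  qed
  define f where "f = (\<lambda>x i. if i < Suc n then (g (vec x) \<bullet> b i) / norm (g (vec x)) else 0)"
  have f_flag: "f x \<in> topspace (nsphere k)"
    if "vec x \<in> sphere 0 1" "g (vec x) \<in> flag (Suc k)" "k \<le> n" for x k
  proof -
    have z: "g (vec x) \<bullet> b i = 0" if "k < i" "i < DIM('a)" for i
      using that \<open>g (vec x) \<in> flag (Suc k)\<close> by (auto simp: flag_def)
    have "(\<Sum>i\<le>k. (f x i)\<^sup>2) = (\<Sum>i\<le>k. (g (vec x) \<bullet> b i)\<^sup>2) / (norm (g (vec x)))\<^sup>2"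
      using that by (simp add: f_def power_divide sum_divide_distrib)
    also have "(\<Sum>i\<le>k. (g (vec x) \<bullet> b i)\<^sup>2) = (norm (g (vec x)))\<^sup>2"
      unfolding norm_coords using that z by (intro sum.mono_neutral_left) (auto simp: DIM)
    finally have "(\<Sum>i\<le>k. (f x i)\<^sup>2) = 1"
      using nz that by simp
    then show ?thesis
      using z that by (auto simp: topspace_nsphere f_def DIM)
  qed
  have cont_vec: "continuous_map (nsphere (Suc n)) (top_of_set (sphere 0 1)) vec"
  proof -
    have "continuous_map (nsphere (Suc n)) euclidean vec"
      unfolding vec_def
    proof (intro continuous_map_sum)
      fix i
      have "continuous_map euclideanreal euclidean (\<lambda>r. r *\<^sub>R b i)"
        by (auto intro!: continuous_intros)
      from continuous_map_compose[OF continuous_map_nsphere_projection this]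
      show "continuous_map (nsphere (Suc n)) euclidean (\<lambda>x. x i *\<^sub>R b i)"
        by (simp add: o_def)
    qed auto
    then show ?thesis
      using vec_flag[of _ "Suc n"] by (auto simp: continuous_map_in_subtopology)
  qed
  have cont_coord: "continuous_map (nsphere (Suc n)) euclideanreal (\<lambda>x. (g (vec x) \<bullet> b i) / norm (g (vec x)))" for i
  proof -
    have "continuous_on (sphere 0 1) (\<lambda>v. (g v \<bullet> b i) / norm (g v))"
      using nz by (intro continuous_intros cont) auto
    then have "continuous_map (top_of_set (sphere 0 1)) euclideanreal (\<lambda>v. (g v \<bullet> b i) / norm (g v))"
      by simp
    from continuous_map_compose[OF cont_vec this] show ?thesis
      by (simp add: o_def)
  qed
  have "continuous_map (nsphere (Suc n)) (Euclidean_space (Suc n)) f"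
    unfolding f_def continuous_map_componentwise_Euclidean_space using cont_coord by blast
  moreover have "f x \<in> topspace (nsphere n)" if "x \<in> topspace (nsphere (Suc n))" for x
    using f_flag[of x n] vec_flag[OF that] range[of "vec x"] by (simp add: DIM)
  ultimately have "continuous_map (nsphere (Suc n)) (nsphere n) f"
    by (auto simp: nsphere_def continuous_map_in_subtopology)
  moreover have "f (\<lambda>i. - x i) = (\<lambda>i. - f x i)" if "x \<in> topspace (nsphere (Suc n))" for x
  proof -
    have "vec (\<lambda>i. - x i) = - vec x"
      by (simp add: vec_def sum_negf)
    then show ?thesis
      using odd[of "vec x"] vec_flag[OF that] by (auto simp: f_def fun_eq_iff)
  qed
  moreover have "f \<in> topspace (nsphere k) \<rightarrow> topspace (nsphere k)" if "k \<le> n" for k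
  proof
    fix x assume x: "x \<in> topspace (nsphere k)"
    have v: "vec x \<in> sphere 0 1 \<inter> local.flag (Suc k)"
      using vec_flag[OF x] that by simp
    show "f x \<in> topspace (nsphere k)"
      using v that flag[of "Suc k" "vec x"] DIM by (intro f_flag) auto
  qed
  ultimately show False
    by (rule no_odd_flag_map_nsphere)
qed

end

text \<open>A zero-free odd map stays away from zero by compactness, so the odd part of a polynomial approximation is
  zero-free too. Embedded into a coordinate hyperplane of the domain, it can be made to preserve the flag.\<close>

theorem Borsuk_Ulam:
  fixes f :: "'a::euclidean_space \<Rightarrow> 'b::euclidean_space"
  assumes dim: "DIM('b) < DIM('a)"
    and cont: "continuous_on (sphere 0 1) f" and odd: "\<And>x. x \<in> sphere 0 1 \<Longrightarrow> f (- x) = - f x"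
  shows "\<exists>x\<in>sphere 0 1. f x = 0"
proof (rule ccontr)
  assume "\<not> ?thesis"
  then have nz: "f x \<noteq> 0" if "x \<in> sphere 0 1" for x
    using that by blast
  have ne: "sphere (0::'a) 1 \<noteq> {}" by (simp)
  obtain b :: "nat \<Rightarrow> 'a" where b: "bij_betw b {..<DIM('a)} Basis"
    using ex_bij_betw_nat_finite[OF finite_Basis] by (auto simp: atLeast0LessThan)
  obtain b' :: "nat \<Rightarrow> 'b" where b': "bij_betw b' {..<DIM('b)} Basis"
    using ex_bij_betw_nat_finite[OF finite_Basis] by (auto simp: atLeast0LessThan)
  interpret A: enumerated_basis b by standard (rule b)
  interpret B: enumerated_basis b' by standard (rule b')
  obtain \<epsilon> where "\<epsilon> > 0" and \<epsilon>: "\<And>x. x \<in> sphere 0 1 \<Longrightarrow> \<epsilon> \<le> norm (f x)"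
  proof -
    have "continuous_on (sphere 0 1) (\<lambda>x. norm (f x))"
      by (intro continuous_intros cont)
    then obtain x where "x \<in> sphere 0 1" "\<And>y. y \<in> sphere 0 1 \<Longrightarrow> norm (f x) \<le> norm (f y)"
      using continuous_attains_inf[OF compact_sphere ne] by blast
    then show ?thesis
      using that[of "norm (f x)"] nz by auto
  qed
  obtain p where p: "polynomial_function p" and fp: "\<And>x. x \<in> sphere 0 1 \<Longrightarrow> norm (f x - p x) < \<epsilon>"
    using Stone_Weierstrass_polynomial_function[OF compact_sphere cont \<open>\<epsilon> > 0\<close>] by blast
  define q where "q = (\<lambda>x. (1/2) *\<^sub>R (p x - p (- x)))"
  have polyq: "polynomial_function q"
  proof -
    have "polynomial_function (\<lambda>x. p (- x))"
      using polynomial_function_compose[OF _ p, of "\<lambda>x. - x"] by (simp add: o_def polynomial_function_minus)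
    then show ?thesis
      unfolding q_def using p by (intro polynomial_function_cmul polynomial_function_diff)
  qed
  have oddq: "q (- x) = - q x" for x
    by (simp add: q_def flip: scaleR_minus_right)
  have nzq: "q x \<noteq> 0" if x: "x \<in> sphere 0 1" for x
  proof
    assume "q x = 0"
    then have "f x = (1/2) *\<^sub>R ((f x - p x) - (f (- x) - p (- x)))"
      by (simp add: q_def odd[OF x] algebra_simps flip: scaleR_add_left)
    then have "norm (f x) \<le> (1/2) * (norm (f x - p x) + norm (f (- x) - p (- x)))"
      by (metis norm_triangle_ineq4 norm_scaleR abs_of_pos half_gt_zero zero_less_one mult_left_mono less_imp_le)
    also have "\<dots> < \<epsilon>"
      using fp[of x] fp[of "- x"] x by simp
    finally show False
      using \<epsilon>[OF x] by simp
  qed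
  define \<iota> where "\<iota> = (\<lambda>v::'b. \<Sum>i<DIM('b). (v \<bullet> b' i) *\<^sub>R b i)"
  have \<iota>_b: "\<iota> v \<bullet> b i = (if i < DIM('b) then v \<bullet> b' i else 0)" if "i < DIM('a)" for v i
  proof -
    have "\<iota> v \<bullet> b i = (\<Sum>k<DIM('b). if k = i then v \<bullet> b' k else 0)"
      unfolding \<iota>_def inner_sum_left using that dim by (intro sum.cong) (auto simp: A.inner_b_b)
    then show ?thesis by simp
  qed
  have lin: "bounded_linear \<iota>"
    unfolding \<iota>_def
    by (intro bounded_linear_sum bounded_linear_scaleR_const bounded_linear_inner_left)
  define g where "g = (\<lambda>x. \<iota> (q x))"
  have "polynomial_function g"
    using polynomial_function_compose[OF polyq polynomial_function_bounded_linear[OF lin]]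
    by (simp add: g_def o_def)
  moreover have "g (- x) = - g x" for x
    using lin by (simp add: g_def oddq bounded_linear.linear linear_neg)
  moreover have "g x \<noteq> 0" if "x \<in> sphere 0 1" for x
  proof
    assume "g x = 0"
    then have "q x = 0"
      unfolding B.eq_0_iff_coords using \<iota>_b[of _ "q x"] dim
      by (metis g_def inner_zero_left order_less_trans)
    then show False using nzq that by blast
  qed
  moreover have "g x \<in> A.flag (DIM('a) - 1)" if "x \<in> sphere 0 1" for x
    using dim by (auto simp: A.flag_def g_def \<iota>_b)
  ultimately have "\<exists>g'. A.odd_flag_map 0 g'"
    by (rule A.odd_flag_map_exists)
  then obtain g' where "A.odd_flag_map 0 g'" by blast
  then have g': "polynomial_function g'" "\<And>x. g' (- x) = - g' x"
    "\<And>x. x \<in> sphere 0 1 \<Longrightarrow> g' x \<noteq> 0"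
    "\<And>x. x \<in> sphere 0 1 \<Longrightarrow> g' x \<in> A.flag (DIM('a) - 1)"
    "\<And>j x. \<lbrakk>j < DIM('a); x \<in> sphere 0 1 \<inter> A.flag j\<rbrakk> \<Longrightarrow> g' x \<in> A.flag j"
    by (auto simp: A.odd_flag_map_def)
  have "2 \<le> DIM('a)"
    using dim DIM_positive[where 'a='b] by linarith
  moreover have "continuous_on (sphere 0 1) g'"
    using g'(1) by (intro differentiable_imp_continuous_on differentiable_on_polynomial_function)
  ultimately have "\<exists>x\<in>sphere 0 1. g' x = 0"
    by (intro A.no_odd_map_into_flag g')
  then show False
    using g'(3) by blast
qed

section \<open>The lower bound\<close>

lemma power2_dist_unit:
  fixes x y :: "'a::real_inner"
  assumes "norm x = 1" "norm y = 1"
  shows "(dist x y)\<^sup>2 = 2 - 2 * (x \<bullet> y)"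
  using assms by (simp add: dot_norm_neg dist_norm field_simps)

text \<open>By Caratheodory's theorem, at most \<open>d + 1\<close> of the vectors suffice, with weights \<open>u\<close>. If
  all inner products exceeded \<open>- 1 / d\<close>, then pairing the vanishing combination with one of its vectors
  \<open>x\<close> would give \<open>u x < 1 / (d + 1)\<close>, and the weights could not add up to one. The regular simplex
  shows that the bound is sharp.\<close>

lemma obtuse_pair_of_convex_hull:
  fixes S :: "'a::euclidean_space set"
  assumes S: "S \<subseteq> sphere 0 1" and 0: "0 \<in> convex hull S"
  shows "\<exists>x\<in>S. \<exists>y\<in>S. x \<bullet> y \<le> - 1 / DIM('a)"
proof (rule ccontr)
  assume "\<not> ?thesis"
  then have far: "x \<bullet> y > - 1 / DIM('a)" if "x \<in> S" "y \<in> S" for x y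
    using that by force
  obtain T u where T: "finite T" "T \<subseteq> S" "card T \<le> DIM('a) + 1"
    and u: "\<forall>x\<in>T. 0 \<le> u x" "sum u T = 1" "(\<Sum>x\<in>T. u x *\<^sub>R x) = 0"
    using 0 unfolding convex_hull_caratheodory by auto
  define d where "d = real (DIM('a))"
  have d: "d > 0" by (simp add: d_def)
  have small: "u x < 1 / (d + 1)" if x: "x \<in> T" for x
  proof -
    have ux: "u x = 1 - sum u (T - {x})"
      using u(2) T(1) x by (simp add: sum.remove)
    have xx: "x \<bullet> x = 1"
      using S T(2) x by (auto simp: dot_square_norm)
    have "0 = x \<bullet> (\<Sum>y\<in>T. u y *\<^sub>R y)"
      by (simp add: u(3))
    also have "\<dots> = u x + (\<Sum>y\<in>T-{x}. u y * (x \<bullet> y))"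
      using T(1) x by (simp add: sum.remove inner_add_right inner_sum_right xx)
    finally have eq: "u x + (\<Sum>y\<in>T-{x}. u y * (x \<bullet> y)) = 0" by simp
    have lt: "- 1 / d < x \<bullet> y" if "y \<in> T" for y
      using far[of x y] that x T(2) by (auto simp: d_def)
    have "\<exists>y\<in>T-{x}. u y \<noteq> 0"
    proof (rule ccontr)
      assume "\<not> ?thesis"
      then have "sum u (T - {x}) = 0" "(\<Sum>y\<in>T-{x}. u y * (x \<bullet> y)) = 0"
        by (auto intro!: sum.neutral)
      then show False using eq ux by simp
    qed
    then obtain y where y: "y \<in> T" "y \<noteq> x" "u y > 0"
      using u(1) by (metis DiffE insertI1 order_less_le)
    have "(\<Sum>y\<in>T-{x}. u y * (- 1 / d)) < (\<Sum>y\<in>T-{x}. u y * (x \<bullet> y))"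
    proof (rule sum_strict_mono_ex1)
      show "\<forall>y\<in>T-{x}. u y * (- 1 / d) \<le> u y * (x \<bullet> y)"
        using lt u(1) by (intro ballI mult_left_mono) (auto simp: less_imp_le)
      show "\<exists>y\<in>T-{x}. u y * (- 1 / d) < u y * (x \<bullet> y)"
        using lt[OF y(1)] y by (intro bexI[of _ y] mult_strict_left_mono) auto
    qed (use T(1) in simp)
    then have "- (sum u (T - {x}) / d) < - u x"
      using eq by (simp add: sum_negf sum_divide_distrib)
    then have "u x < (1 - u x) / d"
      using ux by simp
    then show ?thesis
      using d by (simp add: field_simps)
  qed
  have "T \<noteq> {}" using u(2) by auto
  then have "sum u T < (\<Sum>x\<in>T. 1 / (d + 1))"
    using small T(1) by (intro sum_strict_mono) auto
  also have "\<dots> = card T / (d + 1)" by simp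
  also have "\<dots> \<le> 1"
    using T(3) d by (simp add: d_def)
  finally show False
    using u(2) by simp
qed

text \<open>The value of the map at \<open>z\<close> is an average of the points corresponding to the members of a finite net
  close to \<open>z\<close> and to their antipodes; the weights are tent functions. All points with positive weight
  correspond to points within \<open>e\<close> of \<open>z\<close>, hence lie at distances less than \<open>D + 2 * e\<close>
  from each other, too close for \<open>0\<close> to be in their convex hull.\<close>

lemma odd_nonvanishing_of_small_distortion:
  fixes R :: "('a::euclidean_space \<times> 'b::euclidean_space) set"
  assumes R: "Z2_correspondence (sphere 0 1) uminus (sphere 0 1) uminus R"
    and dis: "\<And>x y x' y'. (x, y) \<in> R \<Longrightarrow> (x', y') \<in> R \<Longrightarrow> \<bar>dist x x' - dist y y'\<bar> \<le> D"
    and D: "D < sqrt (2 + 2 / DIM('a))"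
  obtains F :: "'b \<Rightarrow> 'a" where "continuous_on (sphere 0 1) F" "\<And>y. F (- y) = - F y"
    "\<And>y. y \<in> sphere 0 1 \<Longrightarrow> F y \<noteq> 0"
proof -
  have Rsub: "R \<subseteq> sphere 0 1 \<times> sphere 0 1" and onto: "snd ` R = sphere 0 1"
    and Rneg: "\<And>x y. (x, y) \<in> R \<Longrightarrow> (- x, - y) \<in> R"
    using R by (auto simp: Z2_correspondence_def)
  (* Points within e of a common point are less than 2 * e apart; the third part is left as a margin. *)
  define e where "e = (sqrt (2 + 2 / DIM('a)) - D) / 3"
  have e: "e > 0" "D + 2 * e < sqrt (2 + 2 / DIM('a))"
    using D by (auto simp: e_def field_simps)
  obtain Y :: "'b set" where Y: "finite Y" "Y \<subseteq> sphere 0 1" "sphere 0 1 \<subseteq> (\<Union>y\<in>Y. ball y e)"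
    using seq_compact_imp_totally_bounded[of "sphere (0::'b) 1"] e(1) compact_imp_seq_compact[OF compact_sphere]
    by (metis (no_types, lifting))
  define g where "g = (\<lambda>y. SOME x. (x, y) \<in> R)"
  have gR: "(g y, y) \<in> R" if "y \<in> sphere 0 1" for y
  proof -
    have "y \<in> snd ` R"
      using that onto by simp
    then obtain p where "p \<in> R" "y = snd p" by blast
    then have "(fst p, y) \<in> R" by simp
    then show ?thesis
      unfolding g_def by (rule someI)
  qed
  define w where "w = (\<lambda>y z::'b. max 0 (e - dist y z))"
  define F where "F = (\<lambda>z. \<Sum>y\<in>Y. (w y z - w (- y) z) *\<^sub>R g y)"
  have w_neg: "w (- y) (- z) = w y z" for y z
    by (simp add: w_def dist_minus)
  have contF: "continuous_on (sphere 0 1) F"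
    unfolding F_def w_def by (intro continuous_intros)
  have oddF: "F (- z) = - F z" for z
    using w_neg w_neg[of "- _" z] by (simp add: F_def scaleR_left_diff_distrib sum_negf[symmetric])
  have "F z \<noteq> 0" if z: "z \<in> sphere 0 1" for z
  proof
    assume "F z = 0"
    (* (y, True) stands for the net point y and (y, False) for its antipode. *)
    define I where "I = Y \<times> (UNIV :: bool set)"
    define X where "X = (\<lambda>(y, s). if s then g y else - g y)"
    define W where "W = (\<lambda>(y, s). if s then w y z else w (- y) z)"
    have finI: "finite I" using Y(1) by (simp add: I_def)
    have "(\<Sum>i\<in>I. W i *\<^sub>R X i) = F z"
      by (simp add: I_def sum.cartesian_product' W_def X_def UNIV_bool F_def algebra_simps)
    then have sum0: "(\<Sum>i\<in>I. W i *\<^sub>R X i) = 0"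
      using \<open>F z = 0\<close> by simp
    have W0: "W i \<ge> 0" for i
      by (auto simp: W_def w_def split: prod.split)
    obtain y0 where y0: "y0 \<in> Y" "dist y0 z < e"
      using Y(3) z by auto
    then have "(y0, True) \<in> I" "W (y0, True) > 0"
      by (auto simp: I_def W_def w_def)
    then have Wpos: "sum W I > 0"
      using W0 finI by (intro sum_pos2[of I "(y0, True)"]) auto
    define J where "J = {i \<in> I. W i > 0}"
    have finJ: "finite J" using finI by (simp add: J_def)
    have sumJ: "sum W J = sum W I"
      using finI W0 by (intro sum.mono_neutral_left) (auto simp: J_def not_less intro: antisym)
    have "(\<Sum>i\<in>J. W i *\<^sub>R X i) = (\<Sum>i\<in>I. W i *\<^sub>R X i)"
      using finI W0 by (intro sum.mono_neutral_left) (auto simp: J_def not_less intro: antisym)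
    then have sumJX: "(\<Sum>i\<in>J. W i *\<^sub>R X i) = 0"
      using sum0 by simp
    have "(\<Sum>i\<in>J. (W i / sum W I) *\<^sub>R X i) \<in> convex hull (X ` J)"
      using finJ W0 Wpos sumJ
      by (intro convex_sum convex_convex_hull) (auto simp: sum_divide_distrib[symmetric] intro: hull_inc)
    moreover have "(\<Sum>i\<in>J. (W i / sum W I) *\<^sub>R X i) = (1 / sum W I) *\<^sub>R (\<Sum>i\<in>J. W i *\<^sub>R X i)"
      by (simp add: scaleR_sum_right)
    ultimately have hull: "0 \<in> convex hull (X ` J)"
      using sumJX by simp
    have near: "\<exists>y. (X i, y) \<in> R \<and> dist y z < e" if iJ: "i \<in> J" for i
    proof -
      have YR: "(g y, y) \<in> R" "(- g y, - y) \<in> R" if "y \<in> Y" for y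
        using that gR Rneg Y(2) by auto
      have w: "dist y z < e" if "w y z > 0" for y
        using that by (simp add: w_def less_max_iff_disj)
      obtain y b where i: "i = (y, b)" "y \<in> Y"
        using iJ by (cases i) (auto simp: J_def I_def)
      show ?thesis
      proof (cases b)
        case True
        then show ?thesis
          using iJ i YR(1)[of y] w[of y] by (intro exI[of _ y]) (simp add: J_def W_def X_def)
      next
        case False
        then show ?thesis
          using iJ i YR(2)[of y] w[of "- y"] by (intro exI[of _ "- y"]) (simp add: J_def W_def X_def)
      qed
    qed
    have "X ` J \<subseteq> sphere 0 1"
      using near Rsub by fastforce
    then obtain x x' where x: "x \<in> X ` J" "x' \<in> X ` J" "x \<bullet> x' \<le> - 1 / DIM('a)"
      using obtuse_pair_of_convex_hull[OF _ hull] by blast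
    obtain y y' where y: "(x, y) \<in> R" "(x', y') \<in> R" "dist y z < e" "dist y' z < e"
      using near x by blast
    have "dist x x' \<le> D + dist y y'"
      using dis[OF y(1,2)] by simp
    also have "dist y y' < 2 * e"
      using dist_triangle2[of y y' z] y by simp
    finally have "dist x x' < sqrt (2 + 2 / DIM('a))"
      using e(2) by simp
    moreover have "sqrt (2 + 2 / DIM('a)) \<le> dist x x'"
    proof -
      have "norm x = 1" "norm x' = 1"
        using y Rsub by auto
      then have "(dist x x')\<^sup>2 = 2 - 2 * (x \<bullet> x')"
        by (rule power2_dist_unit)
      also have "\<dots> \<ge> 2 + 2 / DIM('a)"
        using x(3) by simp
      finally show ?thesis
        by (intro real_le_lsqrt) auto
    qed
    ultimately show False by simp
  qed
  then show ?thesis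
    using that contF oddF by blast
qed

theorem dGH_Z2_spheres_lower_bound:
  assumes "DIM('a::euclidean_space) < DIM('b::euclidean_space)"
  shows "dGH_Z2 (sphere (0::'a) 1) uminus (sphere (0::'b) 1) uminus \<ge> ennreal (sqrt (2 + 2 / DIM('a)) / 2)"
proof -
  let ?s = "sqrt (2 + 2 / DIM('a))"
  have "ennreal ?s \<le> distortion R"
    if R: "Z2_correspondence (sphere (0::'a) 1) uminus (sphere (0::'b) 1) uminus R" for R
  proof (rule ccontr)
    assume "\<not> ?thesis"
    then have lt: "distortion R < ennreal ?s" by simp
    define D where "D = enn2real (distortion R)"
    have "distortion R \<noteq> \<infinity>"
      using lt by auto
    then have D: "distortion R = ennreal D"
      by (simp add: D_def less_top)
    have "D \<ge> 0" by (simp add: D_def)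
    with lt D have Ds: "D < ?s"
      by (simp add: ennreal_less_iff)
    have "\<bar>dist x x' - dist y y'\<bar> \<le> D" if "(x, y) \<in> R" "(x', y') \<in> R" for x y x' y'
    proof -
      have "ennreal \<bar>dist x x' - dist y y'\<bar> \<le> distortion R"
        unfolding distortion_def using that by (intro SUP_upper2[of "((x, y), (x', y'))"]) auto
      then show ?thesis
        using D \<open>D \<ge> 0\<close> by simp
    qed
    then obtain F :: "'b \<Rightarrow> 'a" where "continuous_on (sphere 0 1) F" "\<And>y. F (- y) = - F y"
        "\<And>y. y \<in> sphere 0 1 \<Longrightarrow> F y \<noteq> 0"
      using odd_nonvanishing_of_small_distortion[OF R _ Ds] by blast
    then show False
      using Borsuk_Ulam[OF assms, of F] by blast
  qed
  then have "ennreal ?s \<le> (INF R \<in> {R. Z2_correspondence (sphere (0::'a) 1) uminus (sphere (0::'b) 1) uminus R}. distortion R)"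
    by (intro INF_greatest) auto
  then have "ennreal ?s / 2 \<le> dGH_Z2 (sphere (0::'a) 1) uminus (sphere (0::'b) 1) uminus"
    unfolding dGH_Z2_def by (rule divide_right_mono_ennreal)
  then show ?thesis
    by (simp add: divide_ennreal ennreal_divide_numeral)
qed

section \<open>Angles and distortion\<close>

lemma abs_inner_le_1: "norm x = 1 \<Longrightarrow> norm y = 1 \<Longrightarrow> \<bar>x \<bullet> y\<bar> \<le> 1" for x y :: "'a::real_inner"
  using Cauchy_Schwarz_ineq2[of x y] by simp

text \<open>The spherical triangle inequality: the components of \<open>x\<close> and \<open>z\<close> orthogonal to
  \<open>y\<close> have the sines of the two angles as norms, so Cauchy--Schwarz for them bounds \<open>x \<bullet> z\<close>
  below by the cosine of the sum.\<close>

lemma arccos_inner_triangle: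
  fixes x y z :: "'a::real_inner"
  assumes n: "norm x = 1" "norm y = 1" "norm z = 1"
  shows "arccos (x \<bullet> z) \<le> arccos (x \<bullet> y) + arccos (y \<bullet> z)"
proof (cases "arccos (x \<bullet> y) + arccos (y \<bullet> z) \<le> pi")
  case True
  have b: "\<bar>x \<bullet> y\<bar> \<le> 1" "\<bar>y \<bullet> z\<bar> \<le> 1" "\<bar>x \<bullet> z\<bar> \<le> 1"
    using n abs_inner_le_1 by blast+
  have perp: "norm (u - (u \<bullet> y) *\<^sub>R y) = sqrt (1 - (u \<bullet> y)\<^sup>2)" if "norm u = 1" for u
    using that n(2)
    by (simp add: norm_eq_sqrt_inner inner_diff_left inner_diff_right inner_commute power2_eq_square)
  have "\<bar>(x - (x \<bullet> y) *\<^sub>R y) \<bullet> (z - (z \<bullet> y) *\<^sub>R y)\<bar> \<le> sqrt (1 - (x \<bullet> y)\<^sup>2) * sqrt (1 - (z \<bullet> y)\<^sup>2)"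
    using Cauchy_Schwarz_ineq2[of "x - (x \<bullet> y) *\<^sub>R y" "z - (z \<bullet> y) *\<^sub>R y"] perp n by simp
  moreover have "(x - (x \<bullet> y) *\<^sub>R y) \<bullet> (z - (z \<bullet> y) *\<^sub>R y) = x \<bullet> z - (x \<bullet> y) * (y \<bullet> z)"
    using n(2) by (simp add: inner_diff_left inner_diff_right inner_commute dot_square_norm)
  ultimately have "(x \<bullet> y) * (y \<bullet> z) - sqrt (1 - (x \<bullet> y)\<^sup>2) * sqrt (1 - (y \<bullet> z)\<^sup>2) \<le> x \<bullet> z"
    by (simp add: inner_commute)
  also have "(x \<bullet> y) * (y \<bullet> z) - sqrt (1 - (x \<bullet> y)\<^sup>2) * sqrt (1 - (y \<bullet> z)\<^sup>2)
      = cos (arccos (x \<bullet> y) + arccos (y \<bullet> z))"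
    using b by (simp add: cos_add sin_arccos_abs abs_le_iff cos_arccos_abs)
  finally have "arccos (x \<bullet> z) \<le> arccos (cos (arccos (x \<bullet> y) + arccos (y \<bullet> z)))"
    using b by (intro arccos_le_arccos) auto
  also have "\<dots> = arccos (x \<bullet> y) + arccos (y \<bullet> z)"
    using True b by (intro arccos_cos add_nonneg_nonneg arccos_lbound) auto
  finally show ?thesis .
next
  case False
  moreover have "arccos (x \<bullet> z) \<le> pi"
    using abs_inner_le_1[OF n(1,3)] by (intro arccos_ubound) auto
  ultimately show ?thesis by simp
qed

lemma dist_eq_chord:
  fixes x y :: "'a::real_inner"
  assumes n: "norm x = 1" "norm y = 1"
  shows "dist x y = 2 * sin (arccos (x \<bullet> y) / 2)"
proof (rule power2_eq_imp_eq)
  have b: "\<bar>x \<bullet> y\<bar> \<le> 1"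
    using n abs_inner_le_1 by blast
  have "x \<bullet> y = cos (2 * (arccos (x \<bullet> y) / 2))"
    using b by (simp add: cos_arccos_abs)
  also have "\<dots> = 1 - 2 * (sin (arccos (x \<bullet> y) / 2))\<^sup>2"
    by (rule cos_double_sin)
  finally show "(dist x y)\<^sup>2 = (2 * sin (arccos (x \<bullet> y) / 2))\<^sup>2"
    using n by (simp add: power2_dist_unit power_mult_distrib)
  show "0 \<le> 2 * sin (arccos (x \<bullet> y) / 2)"
    using arccos_lbound[of "x \<bullet> y"] arccos_ubound[of "x \<bullet> y"] b
    by (intro mult_nonneg_nonneg sin_ge_zero) (auto simp: abs_le_iff)
qed auto

text \<open>Subadditivity of the concave function \<open>\<lambda>\<theta>. sin (\<theta> / 2)\<close>, via the formula for a
  difference of sines.\<close>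

lemma half_chord_le:
  assumes "0 \<le> \<alpha>" "\<alpha> \<le> pi" "0 \<le> \<beta>" "\<beta> \<le> pi" "0 \<le> \<zeta>" "\<zeta> \<le> pi" "\<alpha> \<le> \<beta> + \<zeta>"
  shows "sin (\<alpha> / 2) \<le> sin (\<beta> / 2) + sin (\<zeta> / 2)"
proof (cases "\<alpha> \<le> \<beta>")
  case True
  then have "sin (\<alpha> / 2) \<le> sin (\<beta> / 2)"
    using assms by (intro sin_monotone_2pi_le) auto
  moreover have "0 \<le> sin (\<zeta> / 2)"
    using assms by (intro sin_ge_zero) auto
  ultimately show ?thesis by simp
next
  case False
  have "sin (\<alpha> / 2) - sin (\<beta> / 2) = 2 * sin ((\<alpha> - \<beta>) / 4) * cos ((\<alpha> + \<beta>) / 4)"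
    by (simp add: sin_diff_sin diff_divide_distrib add_divide_distrib)
  also have "\<dots> \<le> 2 * sin ((\<alpha> - \<beta>) / 4) * cos ((\<alpha> - \<beta>) / 4)"
    using assms False by (intro mult_left_mono cos_monotone_0_pi_le mult_nonneg_nonneg sin_ge_zero) auto
  also have "\<dots> = sin ((\<alpha> - \<beta>) / 2)"
  proof -
    have "sin ((\<alpha> - \<beta>) / 2) = sin (2 * ((\<alpha> - \<beta>) / 4))"
      by (rule arg_cong[of _ _ sin]) simp
    then show ?thesis
      by (simp only: sin_double)
  qed
  also have "\<dots> \<le> sin (\<zeta> / 2)"
    using assms False by (intro sin_monotone_2pi_le) auto
  finally show ?thesis by simp
qed

text \<open>One inequality between angles suffices: applied with \<open>- x'\<close> and \<open>- y'\<close>, which are again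
  related, it bounds the difference of the angles from the other side.\<close>

lemma dGH_Z2_sphere_le:
  fixes R :: "('a::euclidean_space \<times> 'b::euclidean_space) set"
  assumes R: "Z2_correspondence (sphere 0 1) uminus (sphere 0 1) uminus R"
    and angle: "\<And>x y x' y'. (x, y) \<in> R \<Longrightarrow> (x', y') \<in> R \<Longrightarrow> arccos (y \<bullet> y') \<le> arccos (x \<bullet> x') + \<zeta>"
    and \<zeta>: "0 \<le> \<zeta>" "\<zeta> \<le> pi"
  shows "dGH_Z2 (sphere (0::'a) 1) uminus (sphere (0::'b) 1) uminus \<le> ennreal (sin (\<zeta> / 2))"
proof -
  have s0: "0 \<le> sin (\<zeta> / 2)"
    using \<zeta> by (intro sin_ge_zero) auto
  have "\<bar>dist x x' - dist y y'\<bar> \<le> 2 * sin (\<zeta> / 2)" if xy: "(x, y) \<in> R" and xy': "(x', y') \<in> R" for x y x' y'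
  proof -
    have n: "norm x = 1" "norm y = 1" "norm x' = 1" "norm y' = 1"
      using xy xy' R by (auto simp: Z2_correspondence_def)
    have b: "\<bar>x \<bullet> x'\<bar> \<le> 1" "\<bar>y \<bullet> y'\<bar> \<le> 1"
      using n abs_inner_le_1 by blast+
    have bounds: "0 \<le> arccos (x \<bullet> x')" "arccos (x \<bullet> x') \<le> pi" "0 \<le> arccos (y \<bullet> y')" "arccos (y \<bullet> y') \<le> pi"
      using b by (auto intro: arccos_lbound arccos_ubound)
    have "sin (arccos (y \<bullet> y') / 2) \<le> sin (arccos (x \<bullet> x') / 2) + sin (\<zeta> / 2)"
      using bounds \<zeta> angle[OF xy xy'] by (intro half_chord_le)
    moreover have "sin (arccos (x \<bullet> x') / 2) \<le> sin (arccos (y \<bullet> y') / 2) + sin (\<zeta> / 2)"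
    proof (intro half_chord_le bounds \<zeta>)
      have "(- x', - y') \<in> R"
        using xy' R by (auto simp: Z2_correspondence_def)
      from angle[OF xy this] show "arccos (x \<bullet> x') \<le> arccos (y \<bullet> y') + \<zeta>"
        using b by (simp add: arccos_minus abs_le_iff)
    qed
    ultimately show ?thesis
      using n by (simp add: dist_eq_chord abs_le_iff)
  qed
  then have "distortion R \<le> ennreal (2 * sin (\<zeta> / 2))"
    unfolding distortion_def by (intro SUP_least) (auto intro!: ennreal_leI)
  then have "(INF R \<in> {R. Z2_correspondence (sphere (0::'a) 1) uminus (sphere (0::'b) 1) uminus R}. distortion R)
      \<le> ennreal (2 * sin (\<zeta> / 2))"
    using R by (intro INF_lower2[of R]) auto
  then have "dGH_Z2 (sphere (0::'a) 1) uminus (sphere (0::'b) 1) uminus \<le> ennreal (2 * sin (\<zeta> / 2)) / 2"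
    unfolding dGH_Z2_def by (rule divide_right_mono_ennreal)
  also have "\<dots> = ennreal (sin (\<zeta> / 2))"
    using s0 by (simp add: ennreal_divide_numeral)
  finally show ?thesis .
qed

lemma linear_isometry_exists:
  assumes "DIM('a::euclidean_space) = DIM('c::euclidean_space)"
  obtains f :: "'a::euclidean_space \<Rightarrow> 'c::euclidean_space" and g
  where "linear f" "linear g" "\<And>x. norm (f x) = norm x" "\<And>x. norm (g x) = norm x"
     "\<And>x. g (f x) = x" "\<And>x. f (g x) = x"
proof -
  have "dim (UNIV :: 'a set) = dim (UNIV :: 'c set)"
    using assms by simp
  then show thesis
  proof (rule isometries_subspaces[OF subspace_UNIV subspace_UNIV])
    fix f :: "'a \<Rightarrow> 'c" and g
    assume "linear f" "linear g"
      "\<And>x. x \<in> UNIV \<Longrightarrow> norm (f x) = norm x" "\<And>x. x \<in> UNIV \<Longrightarrow> norm (g x) = norm x"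
      "\<And>x. x \<in> UNIV \<Longrightarrow> g (f x) = x" "\<And>x. x \<in> UNIV \<Longrightarrow> f (g x) = x"
    then show thesis
      by (intro that[of f g]) auto
  qed
qed

text \<open>Spheres of spaces of equal dimension are interchangeable; this allows convenient models of
  \<open>\<real>\<^sup>2\<close>, \<open>\<real>\<^sup>3\<close> and \<open>\<real>\<^sup>4\<close>.\<close>

lemma dGH_Z2_sphere_mono_type:
  assumes "DIM('a::euclidean_space) = DIM('c::euclidean_space)" "DIM('b::euclidean_space) = DIM('d::euclidean_space)"
  shows "dGH_Z2 (sphere (0::'a) 1) uminus (sphere (0::'b) 1) uminus
    \<le> dGH_Z2 (sphere (0::'c) 1) uminus (sphere (0::'d) 1) uminus"
proof -
  obtain f :: "'a \<Rightarrow> 'c" and f' where f: "linear f" "linear f'" "\<And>x. norm (f x) = norm x" "\<And>x. norm (f' x) = norm x"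
     "\<And>x. f' (f x) = x" "\<And>x. f (f' x) = x"
    using linear_isometry_exists[OF assms(1)] by metis
  obtain g :: "'b \<Rightarrow> 'd" and g' where g: "linear g" "linear g'" "\<And>x. norm (g x) = norm x" "\<And>x. norm (g' x) = norm x"
     "\<And>x. g' (g x) = x" "\<And>x. g (g' x) = x"
    using linear_isometry_exists[OF assms(2)] by metis
  have dist_f: "dist (f' x) (f' x') = dist x x'" for x x'
    by (metis dist_norm f(2,4) linear_diff)
  have dist_g: "dist (g' x) (g' x') = dist x x'" for x x'
    by (metis dist_norm g(2,4) linear_diff)
  show ?thesis
    unfolding dGH_Z2_def
  proof (intro divide_right_mono_ennreal INF_mono)
    fix R assume "R \<in> {R. Z2_correspondence (sphere (0::'c) 1) uminus (sphere (0::'d) 1) uminus R}"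
    then have R: "R \<subseteq> sphere 0 1 \<times> sphere 0 1" "fst ` R = sphere 0 1" "snd ` R = sphere 0 1"
        "\<And>x y. (x, y) \<in> R \<Longrightarrow> (- x, - y) \<in> R"
      by (auto simp: Z2_correspondence_def)
    define R' where "R' = map_prod f' g' ` R"
    have "x \<in> f' ` sphere 0 1" if "x \<in> sphere 0 1" for x
      using that f(3,5) by (intro image_eqI[of x f' "f x"]) auto
    then have f'S: "f' ` sphere 0 1 = sphere 0 1"
      using f(4) by auto
    have "x \<in> g' ` sphere 0 1" if "x \<in> sphere 0 1" for x
      using that g(3,5) by (intro image_eqI[of x g' "g x"]) auto
    then have g'S: "g' ` sphere 0 1 = sphere 0 1"
      using g(4) by auto
    have "Z2_correspondence (sphere 0 1) uminus (sphere 0 1) uminus R'"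
      unfolding Z2_correspondence_def
    proof (intro conjI)
      show "R' \<subseteq> sphere 0 1 \<times> sphere 0 1"
        using R(1) f g by (auto simp: R'_def)
      have "fst ` R' = f' ` fst ` R" "snd ` R' = g' ` snd ` R"
        by (simp_all add: R'_def image_image)
      then show "fst ` R' = sphere 0 1" "snd ` R' = sphere 0 1"
        using R f'S g'S by auto
      show "\<forall>(x, y)\<in>R'. (- x, - y) \<in> R'"
        using R(4) by (force simp: R'_def linear_neg[OF f(2), symmetric] linear_neg[OF g(2), symmetric] image_iff)
    qed
    moreover have "distortion R' \<le> distortion R"
    proof -
      have "ennreal \<bar>dist (f' x) (f' x') - dist (g' y) (g' y')\<bar> \<le> distortion R" if "(x, y) \<in> R" "(x', y') \<in> R" for x y x' y'
        unfolding distortion_def dist_f dist_g using that by (intro SUP_upper2[of "((x, y), (x', y'))"]) auto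
      then show ?thesis
        unfolding R'_def distortion_def[of "map_prod f' g' ` R"] by (intro SUP_least) auto
    qed
    ultimately show "\<exists>R'\<in>{R. Z2_correspondence (sphere (0::'a) 1) uminus (sphere (0::'b) 1) uminus R}. distortion R' \<le> distortion R"
      by blast
  qed
qed

section \<open>The circle and spheres of dimension two and three\<close>

text \<open>The last condition says that \<open>z\<close> is zero or makes at most the angle \<open>\<pi> / 3\<close> with
  \<open>u\<close>. For \<open>w \<noteq> 0\<close> the point \<open>(z, w)\<close> is thus related to the cube roots of the
  direction of \<open>w\<close> that are closest to \<open>z\<close>.\<close>

definition cube_root_correspondence :: "(complex \<times> complex \<times> complex) set" where
  "cube_root_correspondence =
    {(u, z, w). norm u = 1 \<and> norm (z, w) = 1 \<and> w = of_real (norm w) * u ^ 3 \<and> norm z / 2 \<le> z \<bullet> u}"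

text \<open>The triple-angle formula: cubing triples the angle between unit complex numbers.\<close>

lemma inner_cube:
  fixes u v :: complex
  assumes "norm u = 1" "norm v = 1"
  shows "u ^ 3 \<bullet> v ^ 3 = 4 * (u \<bullet> v) ^ 3 - 3 * (u \<bullet> v)"
proof -
  define c where "c = u * cnj v"
  have n: "(Re c)\<^sup>2 + (Im c)\<^sup>2 = 1"
    using assms cmod_power2[of c] by (simp add: c_def norm_mult)
  have "u \<bullet> v = Re c" "u ^ 3 \<bullet> v ^ 3 = Re (c ^ 3)"
    by (simp_all add: c_def inner_complex_def power_mult_distrib flip: complex_cnj_power)
  moreover have "Re (c ^ 3) = Re c * ((Re c)\<^sup>2 - 3 * (Im c)\<^sup>2)"
    by (simp add: power3_eq_cube power2_eq_square algebra_simps)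
  moreover have "(Im c)\<^sup>2 = 1 - (Re c)\<^sup>2"
    using n by simp
  moreover have "Re c * ((Re c)\<^sup>2 - 3 * (1 - (Re c)\<^sup>2)) = 4 * (Re c) ^ 3 - 3 * Re c"
    by (simp add: power3_eq_cube power2_eq_square algebra_simps)
  ultimately show ?thesis
    by (simp only:)
qed

lemma cos_triple: "cos (3 * x) = 4 * (cos x) ^ 3 - 3 * cos (x::real)"
  using cos_treble_cos[of x] by simp

text \<open>Going from \<open>z\<close> to \<open>u\<close>, to \<open>u'\<close> and to \<open>z'\<close> costs two angles
  of at most \<open>\<pi> / 3\<close> besides the angle of \<open>u\<close> and \<open>u'\<close>.\<close>

lemma inner_ge_cos_of_sectors:
  fixes z z' u u' :: "'a::real_inner"
  assumes u: "norm u = 1" "norm u' = 1" and z: "norm z / 2 \<le> z \<bullet> u" "norm z' / 2 \<le> z' \<bullet> u'"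
    and \<delta>: "arccos (u \<bullet> u') \<le> pi / 3"
  shows "norm z * norm z' * cos (arccos (u \<bullet> u') + 2 * pi / 3) \<le> z \<bullet> z'"
proof (cases "z = 0 \<or> z' = 0")
  case False
  define a where "a = z /\<^sub>R norm z"
  define a' where "a' = z' /\<^sub>R norm z'"
  have n: "norm a = 1" "norm a' = 1"
    using False by (auto simp: a_def a'_def)
  have half: "arccos (1 / 2) = pi / 3"
    using arccos_cos[of "pi / 3"] by (simp add: cos_60)
  have "1 / 2 \<le> a \<bullet> u" "1 / 2 \<le> u' \<bullet> a'"
    using z False inner_commute[of u' z'] by (simp_all add: a_def a'_def field_simps)
  then have "arccos (a \<bullet> u) \<le> arccos (1 / 2)" "arccos (u' \<bullet> a') \<le> arccos (1 / 2)"
    using abs_inner_le_1[OF n(1) u(1)] abs_inner_le_1[OF u(2) n(2)] by (intro arccos_le_arccos; force)+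
  moreover have "arccos (a \<bullet> a') \<le> arccos (a \<bullet> u) + (arccos (u \<bullet> u') + arccos (u' \<bullet> a'))"
    using arccos_inner_triangle[OF n(1) u(1) n(2)] arccos_inner_triangle[OF u n(2)] by linarith
  ultimately have "arccos (a \<bullet> a') \<le> arccos (u \<bullet> u') + 2 * pi / 3"
    by (simp add: half)
  then have "cos (arccos (u \<bullet> u') + 2 * pi / 3) \<le> cos (arccos (a \<bullet> a'))"
    using \<delta> abs_inner_le_1[OF n] by (intro cos_monotone_0_pi_le arccos_lbound) (auto simp: abs_le_iff)
  also have "\<dots> = a \<bullet> a'"
    using abs_inner_le_1[OF n] by (simp add: cos_arccos_abs)
  finally have "norm z * norm z' * cos (arccos (u \<bullet> u') + 2 * pi / 3) \<le> norm z * norm z' * (a \<bullet> a')"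
    by (intro mult_left_mono) auto
  also have "\<dots> = z \<bullet> z'"
    using False by (simp add: a_def a'_def field_simps)
  finally show ?thesis .
qed auto

text \<open>For \<open>\<delta> > \<pi> / 3\<close> the right-hand side exceeds \<open>\<pi>\<close>. Otherwise both \<open>z
  \<bullet> z'\<close> and \<open>w \<bullet> w'\<close> are at least \<open>K = cos (\<delta> + 2 * pi / 3)\<close> times
  the products of the norms; as \<open>K \<le> 0\<close> and those products add up to at most one, the inner product of the
  pairs is at least \<open>K\<close>.\<close>

lemma cube_root_correspondence_angle:
  assumes "(u, z, w) \<in> cube_root_correspondence" "(u', z', w') \<in> cube_root_correspondence"
  shows "arccos ((z, w) \<bullet> (z', w')) \<le> arccos (u \<bullet> u') + 2 * pi / 3"
proof -
  have u: "norm u = 1" "norm u' = 1" and p: "norm (z, w) = 1" "norm (z', w') = 1"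
    and w: "w = of_real (norm w) * u ^ 3" "w' = of_real (norm w') * u' ^ 3"
    and z: "norm z / 2 \<le> z \<bullet> u" "norm z' / 2 \<le> z' \<bullet> u'"
    using assms by (auto simp: cube_root_correspondence_def)
  define \<delta> where "\<delta> = arccos (u \<bullet> u')"
  have uu: "\<bar>u \<bullet> u'\<bar> \<le> 1" and pp: "\<bar>(z, w) \<bullet> (z', w')\<bar> \<le> 1"
    using abs_inner_le_1 u p by blast+
  have \<delta>0: "0 \<le> \<delta>"
    unfolding \<delta>_def using uu by (intro arccos_lbound) auto
  show ?thesis
  proof (cases "\<delta> \<le> pi / 3")
    case True
    define K where "K = cos (\<delta> + 2 * pi / 3)"
    have K0: "K \<le> 0"
    proof -
      have "K \<le> cos (pi / 2)"
        unfolding K_def using \<delta>0 True by (intro cos_monotone_0_pi_le) auto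
      then show ?thesis by simp
    qed
    have "norm z * norm z' * K \<le> z \<bullet> z'"
      unfolding K_def \<delta>_def using inner_ge_cos_of_sectors[OF u z] True by (simp add: \<delta>_def)
    moreover have "norm w * norm w' * K \<le> w \<bullet> w'"
    proof -
      have "K \<le> cos (3 * \<delta>)"
        unfolding K_def using \<delta>0 True by (intro cos_monotone_0_pi_le) auto
      also have "\<dots> = u ^ 3 \<bullet> u' ^ 3"
        using uu u by (simp add: cos_triple inner_cube \<delta>_def cos_arccos_abs)
      finally have "norm w * norm w' * K \<le> norm w * norm w' * (u ^ 3 \<bullet> u' ^ 3)"
        by (intro mult_left_mono) auto
      also have "\<dots> = (norm w *\<^sub>R u ^ 3) \<bullet> (norm w' *\<^sub>R u' ^ 3)"
        by simp
      also have "\<dots> = w \<bullet> w'"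
        using w by (simp add: scaleR_conv_of_real)
      finally show ?thesis .
    qed
    moreover have "norm z * norm z' + norm w * norm w' \<le> 1"
    proof -
      have "(norm z)\<^sup>2 + (norm w)\<^sup>2 = 1" "(norm z')\<^sup>2 + (norm w')\<^sup>2 = 1"
        using p by (simp_all add: norm_Pair)
      moreover have "2 * (norm z * norm z') \<le> (norm z)\<^sup>2 + (norm z')\<^sup>2"
          "2 * (norm w * norm w') \<le> (norm w)\<^sup>2 + (norm w')\<^sup>2"
        using sum_squares_bound[of "norm z" "norm z'"] sum_squares_bound[of "norm w" "norm w'"] by simp_all
      ultimately show ?thesis by linarith
    qed
    then have "1 * K \<le> (norm z * norm z' + norm w * norm w') * K"
      using K0 by (intro mult_right_mono_neg)
    ultimately have "K \<le> (z, w) \<bullet> (z', w')"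
      by (simp add: distrib_right)
    then have "arccos ((z, w) \<bullet> (z', w')) \<le> arccos K"
      using pp by (intro arccos_le_arccos) (auto simp: K_def)
    also have "arccos K = \<delta> + 2 * pi / 3"
      unfolding K_def using \<delta>0 True by (intro arccos_cos) auto
    finally show ?thesis by (simp add: \<delta>_def)
  next
    case False
    have "arccos ((z, w) \<bullet> (z', w')) \<le> pi"
      using pp by (intro arccos_ubound) auto
    then show ?thesis using False by (simp add: \<delta>_def)
  qed
qed

text \<open>The three cube roots of a unit complex number are \<open>2 * pi / 3\<close> apart, so one of them is within
  \<open>\<pi> / 3\<close> of \<open>z\<close>.\<close>

lemma cube_root_near:
  fixes z w :: complex
  shows "\<exists>u. norm u = 1 \<and> w = of_real (norm w) * u ^ 3 \<and> norm z / 2 \<le> z \<bullet> u"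
proof (cases "w = 0")
  case True
  show ?thesis
  proof (cases "z = 0")
    case False
    have "z \<bullet> (z /\<^sub>R norm z) = norm z"
      using False by (simp add: dot_square_norm power2_eq_square)
    then show ?thesis
      using True False by (intro exI[of _ "z /\<^sub>R norm z"]) auto
  qed (use True in \<open>auto intro: exI[of _ 1]\<close>)
next
  case False
  define \<omega> where "\<omega> = Complex (- 1 / 2) (sqrt 3 / 2)"
  have \<omega>: "norm \<omega> = 1" "\<omega> ^ 3 = 1"
    by (auto simp: \<omega>_def cmod_def power2_eq_square complex_eq_iff power3_eq_cube)
  define v where "v = cis (Arg w / 3)"
  have "v ^ 3 = cis (Arg w)"
    unfolding v_def by (subst Complex.DeMoivre) simp
  then have v: "norm v = 1" "w = of_real (norm w) * v ^ 3"
    using rcis_cmod_Arg[of w] by (simp_all add: v_def rcis_def)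
  define a where "a = z * cnj v"
  have na: "norm a = norm z"
    using v(1) by (simp add: a_def norm_mult)
  have zu: "z \<bullet> (v * t) = Re a * Re t + Im a * Im t" for t
    by (simp add: inner_complex_def a_def algebra_simps)
  have "\<exists>t. norm t = 1 \<and> t ^ 3 = 1 \<and> norm z / 2 \<le> z \<bullet> (v * t)"
  proof (cases "norm z / 2 \<le> Re a")
    case True
    then show ?thesis
      using zu[of 1] by (intro exI[of _ 1]) auto
  next
    case False
    define r where "r = norm a"
    have r: "r\<^sup>2 = (Re a)\<^sup>2 + (Im a)\<^sup>2" "r \<ge> 0" "- r \<le> Re a"
      using abs_Re_le_cmod[of a] by (auto simp: r_def cmod_power2)
    have lt: "Re a < r / 2" using False by (simp add: r_def na)
    have "(r + Re a)\<^sup>2 \<le> (sqrt 3 * \<bar>Im a\<bar>)\<^sup>2"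
    proof -
      have "(sqrt 3 * \<bar>Im a\<bar>)\<^sup>2 - (r + Re a)\<^sup>2 = 2 * (r + Re a) * (r - 2 * Re a)"
        using r(1) by (simp add: power_mult_distrib power2_eq_square algebra_simps)
      also have "\<dots> \<ge> 0"
        using r lt by (intro mult_nonneg_nonneg) auto
      finally show ?thesis by simp
    qed
    then have key: "r + Re a \<le> sqrt 3 * \<bar>Im a\<bar>"
      by (rule power2_le_imp_le) simp
    show ?thesis
    proof (cases "Im a \<ge> 0")
      case True
      then show ?thesis
        using key zu[of \<omega>] \<omega> by (intro exI[of _ \<omega>]) (auto simp: \<omega>_def r_def na algebra_simps)
    next
      case False
      have "(cnj \<omega>) ^ 3 = 1"
        using \<omega>(2) by (metis complex_cnj_one complex_cnj_power)
      then show ?thesis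
        using False key zu[of "cnj \<omega>"] \<omega> by (intro exI[of _ "cnj \<omega>"]) (auto simp: \<omega>_def r_def na algebra_simps)
    qed
  qed
  then obtain t where "norm t = 1" "t ^ 3 = 1" "norm z / 2 \<le> z \<bullet> (v * t)" by blast
  then show ?thesis
    using v by (intro exI[of _ "v * t"]) (auto simp: norm_mult power_mult_distrib)
qed

lemma cube_root_correspondence_neg:
  "(u, z, w) \<in> cube_root_correspondence \<Longrightarrow> (- u, - z, - w) \<in> cube_root_correspondence"
  by (auto simp: cube_root_correspondence_def norm_Pair)

lemma sphere_in_cube_root_correspondence: "norm u = 1 \<Longrightarrow> (u, u, 0) \<in> cube_root_correspondence"
  by (simp add: cube_root_correspondence_def norm_Pair dot_square_norm)

lemma Z2_correspondence_cube_root: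
  "Z2_correspondence (sphere 0 1) uminus (sphere 0 1) uminus cube_root_correspondence"
  unfolding Z2_correspondence_def
proof (intro conjI)
  show "cube_root_correspondence \<subseteq> sphere 0 1 \<times> sphere 0 1"
    by (auto simp: cube_root_correspondence_def)
  moreover have "sphere 0 1 \<subseteq> fst ` cube_root_correspondence"
    using sphere_in_cube_root_correspondence by force
  ultimately show "fst ` cube_root_correspondence = sphere 0 1"
    by force
  have "p \<in> snd ` cube_root_correspondence" if p: "p \<in> sphere 0 1" for p
  proof -
    obtain u where "norm u = 1" "snd p = of_real (norm (snd p)) * u ^ 3" "norm (fst p) / 2 \<le> fst p \<bullet> u"
      using cube_root_near by blast
    then have "(u, p) \<in> cube_root_correspondence"
      using p by (cases p) (auto simp: cube_root_correspondence_def)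
    then show ?thesis by force
  qed
  then show "snd ` cube_root_correspondence = sphere 0 1"
    by (auto simp: cube_root_correspondence_def)
  show "\<forall>(x, y)\<in>cube_root_correspondence. (- x, - y) \<in> cube_root_correspondence"
    using cube_root_correspondence_neg by auto
qed

lemma dGH_Z2_S1_S3: "dGH_Z2 (sphere (0::complex) 1) uminus (sphere (0::complex \<times> complex) 1) uminus \<le> ennreal (sqrt 3 / 2)"
proof -
  have "dGH_Z2 (sphere (0::complex) 1) uminus (sphere (0::complex \<times> complex) 1) uminus
      \<le> ennreal (sin ((2 * pi / 3) / 2))"
  proof (rule dGH_Z2_sphere_le[OF Z2_correspondence_cube_root])
    fix u p u' p'
    assume "(u, p) \<in> cube_root_correspondence" "(u', p') \<in> cube_root_correspondence"
    then show "arccos (p \<bullet> p') \<le> arccos (u \<bullet> u') + 2 * pi / 3"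
      by (metis cube_root_correspondence_angle prod.collapse)
  qed auto
  then show ?thesis by (simp add: sin_60)
qed

lemma dGH_Z2_S1_S2: "dGH_Z2 (sphere (0::complex) 1) uminus (sphere (0::complex \<times> real) 1) uminus \<le> ennreal (sqrt 3 / 2)"
proof -
  define R where "R = {(u, z, s). (u, z, complex_of_real s) \<in> cube_root_correspondence}"
  have "Z2_correspondence (sphere 0 1) uminus (sphere 0 1) uminus R"
    unfolding Z2_correspondence_def
  proof (intro conjI)
    show sub: "R \<subseteq> sphere 0 1 \<times> sphere 0 1"
      by (auto simp: R_def cube_root_correspondence_def norm_Pair)
    have "(u, u, 0) \<in> R" if "norm u = 1" for u
      using sphere_in_cube_root_correspondence[OF that] by (simp add: R_def)
    then have "sphere 0 1 \<subseteq> fst ` R" by force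
    then show "fst ` R = sphere 0 1"
      using sub by force
    have "p \<in> snd ` R" if p: "p \<in> sphere 0 1" for p
    proof -
      have "(fst p, complex_of_real (snd p)) \<in> sphere 0 1"
        using p by (cases p) (auto simp: norm_Pair)
      then obtain u where "(u, fst p, complex_of_real (snd p)) \<in> cube_root_correspondence"
        using Z2_correspondence_cube_root by (force simp: Z2_correspondence_def)
      then have "(u, p) \<in> R" by (cases p) (auto simp: R_def)
      then show ?thesis by force
    qed
    then show "snd ` R = sphere 0 1" using sub by force
    show "\<forall>(x, y)\<in>R. (- x, - y) \<in> R"
      using cube_root_correspondence_neg by (auto simp: R_def)
  qed
  moreover have "arccos (p \<bullet> p') \<le> arccos (u \<bullet> u') + 2 * pi / 3" if "(u, p) \<in> R" "(u', p') \<in> R" for u p u' p'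
    using that cube_root_correspondence_angle[of u "fst p" "of_real (snd p)" u' "fst p'" "of_real (snd p')"]
    by (cases p; cases p') (auto simp: R_def inner_complex_def)
  ultimately have "dGH_Z2 (sphere (0::complex) 1) uminus (sphere (0::complex \<times> real) 1) uminus
      \<le> ennreal (sin ((2 * pi / 3) / 2))"
    by (rule dGH_Z2_sphere_le) auto
  then show ?thesis by (simp add: sin_60)
qed

section \<open>Spherical inequalities for the tetrahedral decomposition\<close>

text \<open>The expression is linear in \<open>(x, s)\<close>, and Cauchy--Schwarz against the norm \<open>x\<^sup>2 + 2 *
  s\<^sup>2\<close> gives the bound \<open>sqrt (1 / 3)\<close> as long as \<open>z \<le> 5 * s'\<close>; the expression is
  symmetric under exchange of the two pairs, and if both \<open>s\<close> and \<open>s'\<close> are small then so is the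
  value. The constant \<open>3 / 5\<close> is a rational number above \<open>sqrt (1 / 3)\<close>.\<close>

lemma bilinear_bound:
  fixes s x s' z :: real
  assumes "0 \<le> s" "s \<le> x" "x\<^sup>2 + 2 * s\<^sup>2 \<le> 1" and "0 \<le> s'" "s' \<le> z" "z\<^sup>2 + 2 * s'\<^sup>2 \<le> 1"
  shows "s' * x + s * z - s * s' \<le> 3 / 5"
proof -
  have main: "s' * x + s * z - s * s' \<le> 3 / 5"
    if h: "0 \<le> s" "x\<^sup>2 + 2 * s\<^sup>2 \<le> 1" "0 \<le> s'" "s' \<le> z" "z\<^sup>2 + 2 * s'\<^sup>2 \<le> 1" "z \<le> 5 * s'" for s x s' z :: real
  proof -
    have "0 \<le> (5 * s' - z) * (z - s')"
      using h by simp
    then have "3 * (2 * s'\<^sup>2 + (z - s')\<^sup>2) \<le> 2 * (z\<^sup>2 + 2 * s'\<^sup>2)"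
      by (simp add: power2_eq_square algebra_simps)
    then have q: "s'\<^sup>2 + (z - s')\<^sup>2 / 2 \<le> 1 / 3"
      using h(5) by simp
    have "(s' * x + (z - s') * s)\<^sup>2 + (x * (z - s') / sqrt 2 - sqrt 2 * s * s')\<^sup>2
        = (x\<^sup>2 + 2 * s\<^sup>2) * (s'\<^sup>2 + (z - s')\<^sup>2 / 2)"
      by (simp add: power2_eq_square field_simps)
    then have "(s' * x + (z - s') * s)\<^sup>2 \<le> (x\<^sup>2 + 2 * s\<^sup>2) * (s'\<^sup>2 + (z - s')\<^sup>2 / 2)"
      by (smt (verit) zero_le_power2)
    also have "\<dots> \<le> 1 * (1 / 3)"
      using q h(2) by (intro mult_mono) auto
    also have "\<dots> \<le> (3 / 5)\<^sup>2" by (simp add: power2_eq_square)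
    finally have "s' * x + (z - s') * s \<le> 3 / 5"
      by (rule power2_le_imp_le) simp
    then show ?thesis by (simp add: algebra_simps)
  qed
  consider "z \<le> 5 * s'" | "x \<le> 5 * s" | "5 * s' \<le> z" "5 * s \<le> x" by linarith
  then show ?thesis
  proof cases
    case 1 then show ?thesis using main assms by blast
  next
    case 2 then show ?thesis using main[of s' z s x] assms by (simp add: algebra_simps)
  next
    case 3
    have "(5 * s)\<^sup>2 \<le> x\<^sup>2" "(5 * s')\<^sup>2 \<le> z\<^sup>2"
      using 3 assms by (intro power_mono; simp)+
    then have "s\<^sup>2 \<le> (1 / 5)\<^sup>2" "s'\<^sup>2 \<le> (1 / 5)\<^sup>2"
      using assms by (simp_all add: power_mult_distrib power2_eq_square)
    then have s: "s \<le> 1 / 5" "s' \<le> 1 / 5"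
      by (metis power2_le_imp_le zero_le_divide_1_iff zero_le_numeral)+
    have "x\<^sup>2 \<le> 1\<^sup>2" "z\<^sup>2 \<le> 1\<^sup>2"
      unfolding one_power2
      using assms(3,6) zero_le_power2[of s] zero_le_power2[of s'] by linarith+
    then have "x \<le> 1" "z \<le> 1"
      by (metis power2_le_imp_le zero_le_one)+
    then have "s' * x \<le> (1 / 5) * 1" "s * z \<le> (1 / 5) * 1"
      using s assms by (intro mult_mono; simp)+
    moreover have "0 \<le> s * s'" using assms by simp
    ultimately show ?thesis by simp
  qed
qed

text \<open>If \<open>x\<close> is at most \<open>3 / 4\<close>, then on the arc \<open>x\<^sup>2 + 2 * s\<^sup>2 = 1\<close>
  the parameter \<open>s\<close> is at least about \<open>0.47\<close>. So \<open>x\<close> is bounded by \<open>3 /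
  4\<close> for smaller \<open>s\<close> and by a tangent of the arc for larger \<open>s\<close>, and likewise
  \<open>z\<close>. On each of the four boxes for \<open>(s, s')\<close> this leaves a bilinear function of \<open>(s,
  s')\<close>, which is largest at a corner; multiplying the inequalities for the sides of the box expresses this.\<close>

lemma bilinear_bound_truncated:
  fixes s x s' z :: real
  assumes "0 \<le> s" "s \<le> x" "x\<^sup>2 + 2 * s\<^sup>2 \<le> 1" "x \<le> 3 / 4"
    and "0 \<le> s'" "s' \<le> z" "z\<^sup>2 + 2 * s'\<^sup>2 \<le> 1" "z \<le> 3 / 4"
  shows "s' * x + s * z - s * s' \<le> 1 / 2"
proof -
  have small: "s \<le> 58 / 100" if "0 \<le> s" "s \<le> x" "x\<^sup>2 + 2 * s\<^sup>2 \<le> 1" for s x :: real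
  proof -
    have "s\<^sup>2 \<le> x\<^sup>2" using that by (intro power_mono) auto
    then have "s\<^sup>2 \<le> (58 / 100)\<^sup>2" using that by (simp add: power2_eq_square)
    then show ?thesis by (rule power2_le_imp_le) simp
  qed
  (* The tangent of the arc at (3/4, 0.47), rounded upwards. *)
  have tangent: "x \<le> 1337 / 1000 - 1253 / 1000 * s" if "0 \<le> s" "x\<^sup>2 + 2 * s\<^sup>2 \<le> 1" for s x :: real
  proof -
    have "0 \<le> (x - 3 / 4)\<^sup>2 + 2 * (s - 47 / 100)\<^sup>2" by simp
    then have "2 * (3 / 4 * x + 94 / 100 * s) \<le> x\<^sup>2 + 2 * s\<^sup>2 + 10043 / 10000"
      by (simp add: power2_eq_square algebra_simps)
    then show ?thesis using that by simp
  qed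
  have ss: "s \<le> 58 / 100" "s' \<le> 58 / 100"
    using small assms by blast+
  have t: "x \<le> 1337 / 1000 - 1253 / 1000 * s" "z \<le> 1337 / 1000 - 1253 / 1000 * s'"
    using tangent assms by blast+
  define p where "p = s * s'"
  have flat: "s' * x \<le> 3 / 4 * s'" "s * z \<le> 3 / 4 * s"
    using mult_left_mono[OF assms(4) assms(5)] mult_left_mono[OF assms(8) assms(1)] by simp_all
  have slant: "s' * x \<le> 1337 / 1000 * s' - 1253 / 1000 * p" "s * z \<le> 1337 / 1000 * s - 1253 / 1000 * p"
    using mult_left_mono[OF t(1) assms(5)] mult_left_mono[OF t(2) assms(1)] by (simp_all add: p_def algebra_simps)
  have box: "0 \<le> b * d - b * s' - d * s + p" if "s \<le> b" "s' \<le> d" for b d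
    using mult_nonneg_nonneg[of "b - s" "d - s'"] that by (simp add: p_def algebra_simps)
  have box': "0 \<le> b * d - b * s' - d * s + p" if "b \<le> s" "d \<le> s'" for b d
    using mult_nonneg_nonneg[of "s - b" "s' - d"] that by (simp add: p_def algebra_simps)
  have box'': "b * d - b * s' - d * s + p \<le> 0" if "b \<le> s \<and> s' \<le> d \<or> s \<le> b \<and> d \<le> s'" for b d
    using mult_nonneg_nonneg[of "s - b" "d - s'"] mult_nonneg_nonneg[of "b - s" "s' - d"] that
    by (auto simp: p_def algebra_simps)
  define h where "h = (47 / 100 :: real)"
  consider "s \<le> h" "s' \<le> h" | "h \<le> s" "s' \<le> h" | "s \<le> h" "h \<le> s'" | "h \<le> s" "h \<le> s'" by linarith
  then have "s' * x + s * z - p \<le> 1 / 2"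
  proof cases
    case 1
    then show ?thesis
      using flat box[of h h] unfolding h_def by linarith
  next
    case 2
    then show ?thesis
      using slant(1) flat(2) ss assms(5) box[of "58/100" h] box'[of h 0] box''[of "58/100" 0] box''[of h h]
      unfolding h_def by linarith
  next
    case 3
    then show ?thesis
      using slant(2) flat(1) ss assms(1) box[of h "58/100"] box'[of 0 h] box''[of 0 "58/100"] box''[of h h]
      unfolding h_def by linarith
  next
    case 4
    then show ?thesis
      using slant ss box[of "58/100" "58/100"] box'[of h h] box''[of "58/100" h] box''[of h "58/100"]
      unfolding h_def by linarith
  qed
  then show ?thesis by (simp add: p_def)
qed

text \<open>Here \<open>(x, y, z)\<close> and \<open>(x', y', z')\<close> lie in the cone around the vertex \<open>(1, 1,
  1)\<close> of a tetrahedron, given by nonnegative sums of two coordinates, and only \<open>z\<close> and \<open>x'\<close>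
  may be negative. With \<open>s = - z\<close> and \<open>s' = max 0 (- x')\<close>, the estimate \<open>s * s' \<le> y *
  y'\<close> for the middle term leads to the expression of \<open>bilinear_bound\<close>.\<close>

lemma cell_inner_aux:
  fixes x y z x' y' z' :: real
  assumes "z \<le> 0" "0 \<le> x + z" "0 \<le> y + z" "x\<^sup>2 + y\<^sup>2 + z\<^sup>2 = 1"
    and "0 \<le> y'" "0 \<le> z'" "0 \<le> x' + y'" "0 \<le> x' + z'" "x'\<^sup>2 + y'\<^sup>2 + z'\<^sup>2 = 1"
  shows "- (3 / 5) \<le> x * x' + y * y' + z * z'"
    and "x \<le> 3 / 4 \<Longrightarrow> z' \<le> 3 / 4 \<Longrightarrow> - (1 / 2) \<le> x * x' + y * y' + z * z'"
proof -
  define s where "s = - z"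
  define s' where "s' = max 0 (- x')"
  have "z\<^sup>2 \<le> y\<^sup>2"
    using assms by (intro power2_le_iff_abs_le[THEN iffD2]) auto
  then have 1: "0 \<le> s" "s \<le> x" "x\<^sup>2 + 2 * s\<^sup>2 \<le> 1"
    using assms by (auto simp: s_def)
  have "s'\<^sup>2 \<le> y'\<^sup>2" "s'\<^sup>2 \<le> x'\<^sup>2"
    using assms by (auto simp: s'_def max_def intro!: power2_le_iff_abs_le[THEN iffD2])
  then have "z'\<^sup>2 + 2 * s'\<^sup>2 \<le> 1"
    using assms(9) by linarith
  then have 2: "0 \<le> s'" "s' \<le> z'" "z'\<^sup>2 + 2 * s'\<^sup>2 \<le> 1"
    using assms(6,8) by (simp_all add: s'_def)
  have "- (s' * x + s * z' - s * s') \<le> x * x' + y * y' + z * z'"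
  proof (cases "x' \<le> 0")
    case True
    have "s * s' \<le> y * y'"
      using assms 1 2 by (intro mult_mono) (auto simp: s_def s'_def)
    then show ?thesis
      using True by (simp add: s_def s'_def algebra_simps)
  next
    case False
    then have "0 \<le> x * x'" "0 \<le> y * y'"
      using assms by auto
    then show ?thesis
      using False by (simp add: s_def s'_def)
  qed
  then show "- (3 / 5) \<le> x * x' + y * y' + z * z'"
    and "x \<le> 3 / 4 \<Longrightarrow> z' \<le> 3 / 4 \<Longrightarrow> - (1 / 2) \<le> x * x' + y * y' + z * z'"
    using bilinear_bound[OF 1 2] bilinear_bound_truncated[OF 1 _ 2] by linarith+
qed

text \<open>The conclusion about two unit vectors in one cone, bundled so that permutations of the coordinates can be applied
  to it as a whole.\<close>

definition cell_bound :: "real \<times> real \<times> real \<Rightarrow> real \<times> real \<times> real \<Rightarrow> bool" where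
  "cell_bound v v' \<longleftrightarrow> - (3 / 5) \<le> v \<bullet> v' \<and>
     (\<bar>fst v\<bar> < 3 / 4 \<and> \<bar>fst (snd v)\<bar> < 3 / 4 \<and> \<bar>snd (snd v)\<bar> < 3 / 4 \<and>
      \<bar>fst v'\<bar> < 3 / 4 \<and> \<bar>fst (snd v')\<bar> < 3 / 4 \<and> \<bar>snd (snd v')\<bar> < 3 / 4 \<longrightarrow> - (1 / 2) \<le> v \<bullet> v')"

lemma cell_bound_neg:
  assumes "x \<le> 0" "0 \<le> x + y" "0 \<le> x + z" "x\<^sup>2 + y\<^sup>2 + z\<^sup>2 = 1"
    and "0 \<le> x'" "0 \<le> x' + y'" "0 \<le> x' + z'" "0 \<le> y' + z'" "x'\<^sup>2 + y'\<^sup>2 + z'\<^sup>2 = 1"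
  shows "cell_bound (x, y, z) (x', y', z')"
proof (cases "0 \<le> y'")
  case True
  then show ?thesis
    using cell_inner_aux[of x z y y' x' z'] assms by (auto simp: cell_bound_def algebra_simps)
next
  case False
  then have "0 \<le> z'" using assms by linarith
  then show ?thesis
    using cell_inner_aux[of x y z z' x' y'] assms by (auto simp: cell_bound_def algebra_simps)
qed

text \<open>At most one coordinate of each point is negative. If the inner product has a negative term at all, one of the
  points has its negative coordinate there, and permuting the coordinates and the points reduces the claim to
  \<open>cell_bound_neg\<close>.\<close>

lemma cell_bound:
  assumes c: "0 \<le> x + y" "0 \<le> x + z" "0 \<le> y + z" "x\<^sup>2 + y\<^sup>2 + z\<^sup>2 = 1"
    and c': "0 \<le> x' + y'" "0 \<le> x' + z'" "0 \<le> y' + z'" "x'\<^sup>2 + y'\<^sup>2 + z'\<^sup>2 = 1"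
  shows "cell_bound (x, y, z) (x', y', z')"
proof (cases "0 \<le> x * x' \<and> 0 \<le> y * y' \<and> 0 \<le> z * z'")
  case True
  then show ?thesis by (auto simp: cell_bound_def)
next
  case False
  then consider "x \<le> 0" "0 \<le> x'" | "x' \<le> 0" "0 \<le> x" | "y \<le> 0" "0 \<le> y'" | "y' \<le> 0" "0 \<le> y"
    | "z \<le> 0" "0 \<le> z'" | "z' \<le> 0" "0 \<le> z"
    by (auto simp: zero_le_mult_iff)
  then show ?thesis
  proof cases
    case 1
    then show ?thesis using assms by (intro cell_bound_neg)
  next
    case 2
    then show ?thesis
      using cell_bound_neg[of x' y' z' x y z] assms by (auto simp: cell_bound_def algebra_simps)
  next
    case 3
    then show ?thesis
      using cell_bound_neg[of y x z y' x' z'] assms by (auto simp: cell_bound_def algebra_simps)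
  next
    case 4
    then show ?thesis
      using cell_bound_neg[of y' x' z' y x z] assms by (auto simp: cell_bound_def algebra_simps)
  next
    case 5
    then show ?thesis
      using cell_bound_neg[of z x y z' x' y'] assms by (auto simp: cell_bound_def algebra_simps)
  next
    case 6
    then show ?thesis
      using cell_bound_neg[of z' x' y' z x y] assms by (auto simp: cell_bound_def algebra_simps)
  qed
qed

text \<open>The left-hand side is \<open>norm y\<close> times \<open>cos (\<beta> + \<kappa>)\<close>, where
  \<open>\<beta>\<close> is the angle of \<open>v\<close> and \<open>u\<close> and \<open>cos \<kappa> = 1 / 3\<close>; by
  hypothesis \<open>y\<close> is within \<open>\<kappa>\<close> of \<open>u\<close>. This form of the triangle inequality
  allows \<open>y = 0\<close>.\<close>

lemma inner_tangent_bound: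
  fixes v u y :: "'a::real_inner"
  assumes n: "norm v = 1" "norm u = 1" and b: "0 \<le> v \<bullet> u" and y: "norm y / 3 \<le> y \<bullet> u"
  shows "norm y * (v \<bullet> u - sqrt 8 * sqrt (1 - (v \<bullet> u)\<^sup>2)) / 3 \<le> v \<bullet> y"
proof -
  have perp: "norm (w - (w \<bullet> u) *\<^sub>R u) = sqrt ((norm w)\<^sup>2 - (w \<bullet> u)\<^sup>2)" for w
    using n(2)
    by (simp add: norm_eq_sqrt_inner inner_diff_left inner_diff_right inner_commute power2_eq_square)
  have "\<bar>(v - (v \<bullet> u) *\<^sub>R u) \<bullet> (y - (y \<bullet> u) *\<^sub>R u)\<bar> \<le> sqrt (1 - (v \<bullet> u)\<^sup>2) * sqrt ((norm y)\<^sup>2 - (y \<bullet> u)\<^sup>2)"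
    using Cauchy_Schwarz_ineq2[of "v - (v \<bullet> u) *\<^sub>R u" "y - (y \<bullet> u) *\<^sub>R u"] perp n by simp
  moreover have "(v - (v \<bullet> u) *\<^sub>R u) \<bullet> (y - (y \<bullet> u) *\<^sub>R u) = v \<bullet> y - (v \<bullet> u) * (y \<bullet> u)"
    using n(2) by (simp add: inner_diff_left inner_diff_right inner_commute dot_square_norm)
  ultimately have "(v \<bullet> u) * (y \<bullet> u) - sqrt (1 - (v \<bullet> u)\<^sup>2) * sqrt ((norm y)\<^sup>2 - (y \<bullet> u)\<^sup>2) \<le> v \<bullet> y"
    by linarith
  moreover have "(v \<bullet> u) * (norm y / 3) \<le> (v \<bullet> u) * (y \<bullet> u)"
    using b y by (intro mult_left_mono)
  moreover have "sqrt (1 - (v \<bullet> u)\<^sup>2) * sqrt ((norm y)\<^sup>2 - (y \<bullet> u)\<^sup>2) \<le> sqrt (1 - (v \<bullet> u)\<^sup>2) * (norm y * sqrt 8 / 3)"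
  proof (rule mult_left_mono)
    have "(norm y / 3)\<^sup>2 \<le> (y \<bullet> u)\<^sup>2"
      using y by (intro power_mono) auto
    then have "(norm y)\<^sup>2 - (y \<bullet> u)\<^sup>2 \<le> (norm y * sqrt 8 / 3)\<^sup>2"
      by (simp add: power_mult_distrib power_divide)
    then show "sqrt ((norm y)\<^sup>2 - (y \<bullet> u)\<^sup>2) \<le> norm y * sqrt 8 / 3"
      by (intro real_le_lsqrt) auto
    show "0 \<le> sqrt (1 - (v \<bullet> u)\<^sup>2)"
      using abs_inner_le_1[OF n] by (simp add: abs_square_le_1)
  qed
  moreover have "norm y * (v \<bullet> u - sqrt 8 * sqrt (1 - (v \<bullet> u)\<^sup>2)) / 3
      = (v \<bullet> u) * (norm y / 3) - sqrt (1 - (v \<bullet> u)\<^sup>2) * (norm y * sqrt 8 / 3)"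
    by (simp add: right_diff_distrib diff_divide_distrib mult.commute mult.left_commute)
  ultimately show ?thesis
    by linarith
qed

text \<open>The configuration is that of a point \<open>(r v, - t)\<close> below the equator related to its projection
  \<open>v\<close> and of a point \<open>(y, t')\<close> above it related to a vertex \<open>u\<close>, with \<open>b = v
  \<bullet> u\<close>, \<open>e = v \<bullet> y\<close> and \<open>r' = norm y\<close>. For \<open>b = cos \<beta>\<close>
  the left-hand side of the conclusion is \<open>cos (\<beta> + \<zeta>)\<close> with \<open>cos \<zeta> = - 1 / 3\<close>,
  and \<open>X = (b - k) / 3\<close> is \<open>cos (\<beta> + \<pi> - \<zeta>)\<close>. The case of \<open>y\<close> at the
  pole demands \<open>t \<le> (b + k) / 3\<close>, which is what the hypothesis on \<open>t\<close> provides. If \<open>X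
  \<ge> 0\<close> this is already the worst case; if \<open>X < 0\<close> and \<open>b\<close> is large, then \<open>X - 1 /
  2\<close> is large enough, and otherwise Cauchy--Schwarz for \<open>(r, t)\<close> and \<open>(r', t')\<close> leaves room
  to spare.\<close>

lemma opposite_hemisphere_bound:
  fixes b r r' t t' e :: real
  defines "k \<equiv> sqrt 8 * sqrt (1 - b\<^sup>2)"
  assumes b: "1 / 3 \<le> b" "b \<le> 1"
    and r: "0 \<le> r" "0 \<le> t" "r\<^sup>2 + t\<^sup>2 = 1" "0 \<le> r'" "0 \<le> t'" "r'\<^sup>2 + t'\<^sup>2 = 1"
    and t: "t \<le> 1 / 3 \<or> t \<le> 1 / 2 \<and> b \<le> 98 / 100"
    and e: "r' * (b - k) / 3 \<le> e"
  shows "- (b + k) / 3 \<le> r * e - t * t'"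
proof -
  have b2: "b\<^sup>2 \<le> 1" using b by (simp add: abs_square_le_1)
  have k: "0 \<le> k" "k\<^sup>2 = 8 * (1 - b\<^sup>2)"
    using b2 by (auto simp: k_def power_mult_distrib)
  have k_ge: "c \<le> k" if "c\<^sup>2 \<le> 8 - 8 * b\<^sup>2" for c
    using that k by (auto intro: power2_le_imp_le)
  have t_half: "t \<le> 1 / 2" using t by auto
  have le1: "p \<le> 1" if "p\<^sup>2 + q\<^sup>2 = 1" for p q :: real
  proof (rule power2_le_imp_le)
    show "p\<^sup>2 \<le> 1\<^sup>2"
      unfolding one_power2 using that zero_le_power2[of q] by linarith
  qed simp
  have le1: "r \<le> 1" "t' \<le> 1" "r' \<le> 1"
    using le1[of r t] le1[of t' r'] le1[of r' t'] r by (simp_all add: add.commute)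
  have tN: "t \<le> (b + k) / 3"
    using t
  proof
    assume "t \<le> 1 / 3"
    have "0 \<le> (1 - b) * (7 + 9 * b)" using b by simp
    then have "1 - b \<le> k"
      by (intro k_ge) (simp add: power2_eq_square algebra_simps)
    then show ?thesis using \<open>t \<le> 1 / 3\<close> by simp
  next
    assume t: "t \<le> 1 / 2 \<and> b \<le> 98 / 100"
    have "0 \<le> (98 / 100 - b) * (b - 1 / 3)" using b t by simp
    then have "b\<^sup>2 \<le> 394 / 300 * b - 98 / 300"
      by (simp add: power2_eq_square field_simps)
    moreover have "(3 / 2 - b)\<^sup>2 = 9 / 4 - 3 * b + b\<^sup>2"
      by (simp add: power2_eq_square algebra_simps)
    ultimately have "(3 / 2 - b)\<^sup>2 \<le> 8 - 8 * b\<^sup>2"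
      using conjunct2[OF t] by linarith
    then have "3 / 2 - b \<le> k"
      by (rule k_ge)
    then show ?thesis using t by simp
  qed
  define X where "X = (b - k) / 3"
  have e: "r' * X \<le> e" using e by (simp add: X_def)
  have re: "r * r' * X \<le> r * e"
    using mult_left_mono[OF e r(1)] by (simp add: mult.assoc)
  have tt: "t * t' \<le> t" using r(2) le1 by (simp add: mult_left_le)
  have goal: "- (b + k) / 3 = - ((b + k) / 3)"
    by (rule minus_divide_left[symmetric])
  show ?thesis
  proof (cases "0 \<le> X")
    case True
    then have "0 \<le> r * r' * X" using r by simp
    then show ?thesis unfolding goal using re tt tN by linarith
  next
    case X: False
    show ?thesis
    proof (cases "3 / 4 \<le> b")
      case True
      have "r * r' \<le> 1" using le1 r by (simp add: mult_le_one)
      then have "1 * X \<le> r * r' * X" using X by (intro mult_right_mono_neg) auto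
      then show ?thesis
        unfolding goal using re tt t_half True by (simp add: X_def add_divide_distrib diff_divide_distrib)
    next
      case False
      have "0 \<le> (3 / 4 - b) * (b - 1 / 3)" using b False by simp
      (* The value 252/100 is 3 * (84/100), and 84/100 is the bound obtained from Cauchy--Schwarz below. *)
      then have "b\<^sup>2 \<le> 13 / 12 * b - 1 / 4"
        by (simp add: power2_eq_square field_simps)
      moreover have "(252 / 100 - b)\<^sup>2 = 63504 / 10000 - 504 / 100 * b + b\<^sup>2"
        by (simp add: power2_eq_square algebra_simps)
      ultimately have "(252 / 100 - b)\<^sup>2 \<le> 8 - 8 * b\<^sup>2"
        using b False by linarith
      then have kb: "252 / 100 - b \<le> k"
        by (rule k_ge)
      have "0 \<le> (b - 1 / 3) * (9 * b + 23 / 3)" using b by simp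
      then have "23 / 9 \<le> 9 * b\<^sup>2 + 14 / 3 * b"
        by (simp add: power2_eq_square field_simps)
      moreover have "(b + 7 / 3)\<^sup>2 = b\<^sup>2 + 14 / 3 * b + 49 / 9"
        by (simp add: power2_eq_square field_simps)
      moreover have "k\<^sup>2 = 8 - 8 * b\<^sup>2"
        using k by simp
      ultimately have "k\<^sup>2 \<le> (b + 7 / 3)\<^sup>2"
        by linarith
      then have "k \<le> b + 7 / 3"
        by (rule power2_le_imp_le) (use b in simp)
      then have X_ge: "- X \<le> 7 / 9" by (simp add: X_def diff_divide_distrib)
      have X2: "X\<^sup>2 \<le> (7 / 9)\<^sup>2"
        using power_mono[OF X_ge, of 2] X by simp
      have "(r * r' * (- X) + t * t')\<^sup>2 + (r * (- X) * t' - t * r')\<^sup>2 = ((r * X)\<^sup>2 + t\<^sup>2) * (r'\<^sup>2 + t'\<^sup>2)"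
        by (simp add: power2_eq_square algebra_simps)
      also have "\<dots> = (r * X)\<^sup>2 + t\<^sup>2"
        by (simp only: r mult_1_right)
      finally have "(r * r' * (- X) + t * t')\<^sup>2 \<le> (r * X)\<^sup>2 + t\<^sup>2"
        using zero_le_power2[of "r * (- X) * t' - t * r'"] by linarith
      also have "\<dots> = (1 - t\<^sup>2) * X\<^sup>2 + t\<^sup>2"
        using r(3) by (simp add: power_mult_distrib eq_diff_eq[symmetric])
      also have "\<dots> = X\<^sup>2 + t\<^sup>2 * (1 - X\<^sup>2)"
        by (simp add: algebra_simps)
      also have "\<dots> \<le> X\<^sup>2 + (1 / 2)\<^sup>2 * (1 - X\<^sup>2)"
      proof (intro add_left_mono mult_right_mono)
        show "t\<^sup>2 \<le> (1 / 2)\<^sup>2" using t_half r(2) by (rule power_mono)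
        show "0 \<le> 1 - X\<^sup>2" using X2 by (simp add: power2_eq_square)
      qed
      also have "\<dots> \<le> (84 / 100)\<^sup>2"
      proof -
        have "X\<^sup>2 + (1 / 2)\<^sup>2 * (1 - X\<^sup>2) = 1 / 4 + 3 / 4 * X\<^sup>2"
          by (simp add: power2_eq_square field_simps)
        moreover have "X\<^sup>2 \<le> 49 / 81" "(84 / 100 :: real)\<^sup>2 = 7056 / 10000"
          using X2 by (simp_all add: power2_eq_square)
        ultimately show ?thesis by linarith
      qed
      finally have "r * r' * (- X) + t * t' \<le> 84 / 100"
        by (rule power2_le_imp_le) simp
      then show ?thesis unfolding goal using re kb by (simp add: add_divide_distrib)
    qed
  qed
qed

section \<open>The two-sphere and the three-sphere\<close>

text \<open>For signs \<open>a\<close> and \<open>b\<close>, these are the four vertices of the cube whose coordinates have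
  positive product, scaled to the unit sphere: a regular tetrahedron.\<close>

definition tetra_vertex :: "real \<Rightarrow> real \<Rightarrow> real \<times> real \<times> real" where
  "tetra_vertex a b = (a / sqrt 3, b / sqrt 3, a * b / sqrt 3)"

text \<open>The cone of points for which the vertex with signs \<open>a\<close> and \<open>b\<close> is the closest of the
  four.\<close>

fun tetra_cell :: "real \<Rightarrow> real \<Rightarrow> real \<times> real \<times> real \<Rightarrow> bool" where
  "tetra_cell a b (x, y, z) \<longleftrightarrow> 0 \<le> a * x + b * y \<and> 0 \<le> a * x + a * b * z \<and> 0 \<le> b * y + a * b * z"

text \<open>Nearness to one of the coordinate axes, which pass through the midpoints of the edges of the tetrahedron.\<close>

fun axial :: "real \<times> real \<times> real \<Rightarrow> bool" where
  "axial (x, y, z) \<longleftrightarrow> 3 / 4 * norm (x, y, z) \<le> max \<bar>x\<bar> (max \<bar>y\<bar> \<bar>z\<bar>)"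

text \<open>Here \<open>v\<close> is the projection of \<open>(y, t)\<close> to the equator; in \<open>polar_pairs\<close> it
  is a vertex whose cell contains \<open>y\<close>. The two heights \<open>1 / 3\<close> and \<open>1 / 2\<close> are
  explained in the introduction.\<close>

definition equatorial_pairs :: "((real \<times> real \<times> real) \<times> (real \<times> real \<times> real) \<times> real) set" where
  "equatorial_pairs = {(v, y, t). norm v = 1 \<and> norm (y, t) = 1 \<and> y = norm y *\<^sub>R v \<and> 0 \<le> t \<and> (t \<le> 1 / 3 \<or> t \<le> 1 / 2 \<and> axial v)}"

definition polar_pairs :: "((real \<times> real \<times> real) \<times> (real \<times> real \<times> real) \<times> real) set" where
  "polar_pairs = {(u, y, t). norm (y, t) = 1 \<and> (1 / 2 \<le> t \<or> 1 / 3 \<le> t \<and> \<not> axial y) \<and>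
     (\<exists>a\<in>{1, -1}. \<exists>b\<in>{1, -1}. u = tetra_vertex a b \<and> tetra_cell a b y)}"

lemma norm_triple: "norm (x, y, z) = sqrt (x\<^sup>2 + y\<^sup>2 + z\<^sup>2)" for x y z :: real
  by (simp add: norm_Pair algebra_simps)

lemma norm_triple_sq: "(norm (x, y, z))\<^sup>2 = x\<^sup>2 + y\<^sup>2 + z\<^sup>2" for x y z :: real
  by (simp add: norm_triple)

lemma norm_tetra_vertex: "a \<in> {1, -1} \<Longrightarrow> b \<in> {1, -1} \<Longrightarrow> norm (tetra_vertex a b) = 1"
  by (auto simp: tetra_vertex_def norm_triple power_divide)

lemma inner_tetra_vertex:
  assumes "a \<in> {1, -1}" "b \<in> {1, -1}" "a' \<in> {1, -1}" "b' \<in> {1, -1}"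
  shows "tetra_vertex a b \<bullet> tetra_vertex a' b' = (if a = a' \<and> b = b' then 1 else - 1 / 3)"
  using assms by (auto simp: tetra_vertex_def)

text \<open>A cell reaches as far from its vertex as the antipodes of the other vertices, which have inner product \<open>1 /
  3\<close> with it. With \<open>X\<close>, \<open>Y\<close>, \<open>Z\<close> the coordinates after the sign changes, three
  times the square of their sum exceeds their sum of squares by a combination of products of the pairwise sums.\<close>

lemma tetra_cell_near_vertex:
  assumes "a \<in> {1, -1}" "b \<in> {1, -1}" "tetra_cell a b v"
  shows "norm v / 3 \<le> v \<bullet> tetra_vertex a b"
proof -
  obtain x y z where v: "v = (x, y, z)" by (cases v)
  define X where "X = a * x"
  define Y where "Y = b * y"
  define Z where "Z = a * b * z"
  have pos: "0 \<le> X + Y" "0 \<le> X + Z" "0 \<le> Y + Z"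
    using assms by (auto simp: v X_def Y_def Z_def)
  have sq: "X\<^sup>2 = x\<^sup>2" "Y\<^sup>2 = y\<^sup>2" "Z\<^sup>2 = z\<^sup>2"
    using assms by (auto simp: X_def Y_def Z_def)
  have "0 \<le> (X + Y) * (X + Z) + (X + Y) * (Y + Z) + (X + Z) * (Y + Z)"
    using pos by simp
  then have "X\<^sup>2 + Y\<^sup>2 + Z\<^sup>2 \<le> 3 * (X + Y + Z)\<^sup>2"
    by (simp add: power2_eq_square algebra_simps)
  then have "(norm v)\<^sup>2 \<le> (sqrt 3 * (X + Y + Z))\<^sup>2"
    by (simp add: v norm_triple_sq sq power_mult_distrib)
  then have "norm v \<le> sqrt 3 * (X + Y + Z)"
    by (rule power2_le_imp_le) (use pos in simp)
  moreover have "v \<bullet> tetra_vertex a b = sqrt 3 * (X + Y + Z) / 3"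
    by (simp add: v tetra_vertex_def X_def Y_def Z_def field_simps)
  ultimately show ?thesis by simp
qed

lemma ex_tetra_cell: "\<exists>a\<in>{1, -1}. \<exists>b\<in>{1, -1}. tetra_cell a b v"
  by (cases v) (auto; linarith)

lemma axial_minus: "axial (- v) = axial v"
  by (cases v) (simp add: norm_triple)

lemma axial_scaleR: "c > 0 \<Longrightarrow> axial (c *\<^sub>R v) = axial v"
proof -
  assume c: "c > 0"
  obtain x y z where v: "v = (x, y, z)" by (cases v)
  have "norm (c *\<^sub>R v) = c * norm v"
    using c by simp
  moreover have "max \<bar>c * x\<bar> (max \<bar>c * y\<bar> \<bar>c * z\<bar>) = c * max \<bar>x\<bar> (max \<bar>y\<bar> \<bar>z\<bar>)"
    using c by (simp add: abs_mult max_mult_distrib_left)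
  ultimately show ?thesis
    using c by (simp add: v)
qed

text \<open>An axial point keeps a distance from the vertices, which lie on the main diagonals of the cube. The number
  \<open>0.47\<close> approximates the other two coordinates of the extremal point with one coordinate equal to \<open>3 /
  4\<close>.\<close>

lemma axial_inner_tetra_vertex:
  assumes v: "norm v = 1" "axial v" and ab: "a \<in> {1, -1}" "b \<in> {1, -1}"
  shows "v \<bullet> tetra_vertex a b \<le> 98 / 100"
proof -
  obtain x y z where xyz: "v = (x, y, z)" by (cases v)
  have sq: "\<bar>x\<bar>\<^sup>2 + \<bar>y\<bar>\<^sup>2 + \<bar>z\<bar>\<^sup>2 = 1"
    using v(1) norm_triple_sq[of x y z] by (simp add: xyz)
  have main: "p + q + r \<le> 1686 / 1000" if "p\<^sup>2 + q\<^sup>2 + r\<^sup>2 = 1" "3 / 4 \<le> r" for p q r :: real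
  proof -
    have "0 \<le> (p - 47 / 100)\<^sup>2 + (q - 47 / 100)\<^sup>2 + (r - 3 / 4)\<^sup>2"
      by simp
    then have "94 / 100 * p + 94 / 100 * q \<le> p\<^sup>2 + q\<^sup>2 + r\<^sup>2 + 10043 / 10000 - 3 / 2 * r"
      by (simp add: power2_eq_square field_simps)
    then show ?thesis
      using that by linarith
  qed
  have "\<bar>x\<bar> + \<bar>y\<bar> + \<bar>z\<bar> \<le> 1686 / 1000"
    using v main[of "\<bar>y\<bar>" "\<bar>z\<bar>" "\<bar>x\<bar>"] main[of "\<bar>x\<bar>" "\<bar>z\<bar>" "\<bar>y\<bar>"] main[of "\<bar>x\<bar>" "\<bar>y\<bar>" "\<bar>z\<bar>"] sq
    by (auto simp: xyz le_max_iff_disj add_ac)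
  moreover have "a * x \<le> \<bar>x\<bar>" "b * y \<le> \<bar>y\<bar>" "a * b * z \<le> \<bar>z\<bar>"
    using ab by auto
  ultimately have "a * x + b * y + a * b * z \<le> 1686 / 1000" by linarith
  moreover have "1686 / 1000 \<le> 98 / 100 * sqrt 3"
  proof -
    have "1686 / 980 \<le> sqrt 3"
      by (rule real_le_rsqrt) (simp add: power2_eq_square)
    then show ?thesis by simp
  qed
  moreover have "v \<bullet> tetra_vertex a b = (a * x + b * y + a * b * z) / sqrt 3"
    by (simp add: xyz tetra_vertex_def add_divide_distrib mult.commute mult.left_commute)
  ultimately show ?thesis
    by (simp add: divide_le_eq)
qed

text \<open>Sign changes move the cell to the one with all signs positive, and rescaling makes the points unit
  vectors.\<close>

lemma tetra_cell_inner:
  assumes ab: "a \<in> {1, -1}" "b \<in> {1, -1}" and c: "tetra_cell a b v" "tetra_cell a b w"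
  shows "- (3 / 5) * (norm v * norm w) \<le> v \<bullet> w"
    and "\<not> axial v \<Longrightarrow> \<not> axial w \<Longrightarrow> - (1 / 2) * (norm v * norm w) \<le> v \<bullet> w"
proof -
  have "- (3 / 5) * (norm v * norm w) \<le> v \<bullet> w \<and>
      (\<not> axial v \<longrightarrow> \<not> axial w \<longrightarrow> - (1 / 2) * (norm v * norm w) \<le> v \<bullet> w)"
  proof (cases "v = 0 \<or> w = 0")
    case False
    obtain x y z x' y' z' where xyz: "v = (x, y, z)" "w = (x', y', z')" by (cases v, cases w)
    define f where "f = (\<lambda>(x, y, z). (a * x, b * y, a * b * z) :: real \<times> real \<times> real)"
    have f_norm: "norm (f u) = norm u" for u
      using ab by (cases u) (auto simp: f_def norm_triple)
    have f_inner: "f u \<bullet> f u' = u \<bullet> u'" for u u'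
      using ab by (cases u; cases u') (auto simp: f_def)
    have unit: "x\<^sup>2 + y\<^sup>2 + z\<^sup>2 = 1" if "norm (x, y, z) = 1" for x y z :: real
      using that norm_triple_sq[of x y z] by simp
    define v1 where "v1 = f v /\<^sub>R norm v"
    define w1 where "w1 = f w /\<^sub>R norm w"
    have n: "norm v1 = 1" "norm w1 = 1"
      using False by (auto simp: v1_def w1_def f_norm)
    have "cell_bound v1 w1"
    proof -
      obtain p q r where v1: "v1 = (p, q, r)" by (cases v1)
      obtain p' q' r' where w1: "w1 = (p', q', r')" by (cases w1)
      have "0 \<le> p + q" "0 \<le> p + r" "0 \<le> q + r"
        using v1 c(1) by (auto simp: v1_def f_def xyz simp flip: distrib_left divide_inverse)
      moreover have "0 \<le> p' + q'" "0 \<le> p' + r'" "0 \<le> q' + r'"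
        using w1 c(2) by (auto simp: w1_def f_def xyz simp flip: distrib_left)
      ultimately show ?thesis
        unfolding v1 w1 using n unit by (intro cell_bound) (auto simp: v1 w1)
    qed
    moreover have "v1 \<bullet> w1 = (v \<bullet> w) / (norm v * norm w)"
      by (simp add: v1_def w1_def f_inner field_simps)
    moreover have "\<bar>fst u1\<bar> < 3 / 4 \<and> \<bar>fst (snd u1)\<bar> < 3 / 4 \<and> \<bar>snd (snd u1)\<bar> < 3 / 4"
      if "\<not> axial u" "u \<noteq> 0" "u1 = f u /\<^sub>R norm u" for u u1
    proof -
      obtain p q r where u: "u = (p, q, r)" by (cases u)
      have "\<bar>a * p\<bar> = \<bar>p\<bar>" "\<bar>b * q\<bar> = \<bar>q\<bar>" "\<bar>a * b * r\<bar> = \<bar>r\<bar>"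
        using ab by auto
      moreover have "\<bar>p\<bar> < 3 / 4 * norm u" "\<bar>q\<bar> < 3 / 4 * norm u" "\<bar>r\<bar> < 3 / 4 * norm u"
        using that(1) by (simp_all add: u not_le)
      moreover have "u1 = (a * p / norm u, b * q / norm u, a * b * r / norm u)"
        using that(3) by (simp add: u f_def divide_inverse mult.commute)
      ultimately show ?thesis
        using that(2) by (simp add: abs_divide divide_less_eq)
    qed
    ultimately show ?thesis
      using False by (simp add: cell_bound_def v1_def w1_def pos_le_divide_eq)
  qed auto
  then show "- (3 / 5) * (norm v * norm w) \<le> v \<bullet> w"
    and "\<not> axial v \<Longrightarrow> \<not> axial w \<Longrightarrow> - (1 / 2) * (norm v * norm w) \<le> v \<bullet> w"
    by blast+
qed

text \<open>If \<open>b \<le> 1 / 3\<close>, the right-hand side is at least \<open>\<pi>\<close>; if \<open>- 1 / 3 \<le>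
  p\<close>, its second summand suffices; and the last alternative compares \<open>p\<close> with the cosine of the
  right-hand side.\<close>

lemma arccos_le_add_obtuse:
  assumes a: "\<bar>p\<bar> \<le> 1" and b: "\<bar>b\<bar> \<le> 1"
    and h: "b \<le> 1 / 3 \<or> - (1 / 3) \<le> p \<or> - (b + sqrt 8 * sqrt (1 - b\<^sup>2)) / 3 \<le> p"
  shows "arccos p \<le> arccos b + arccos (- (1 / 3))"
proof (cases "b \<le> 1 / 3")
  case True
  have "arccos (1 / 3) \<le> arccos b"
    using True b by (intro arccos_le_arccos) (auto simp: abs_le_iff)
  moreover have "arccos (- (1 / 3)) = pi - arccos (1 / 3)"
    by (rule arccos_minus) auto
  moreover have "arccos p \<le> pi"
    using a by (intro arccos_ubound) (auto simp: abs_le_iff)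
  ultimately show ?thesis by linarith
next
  case b3: False
  have b0: "0 \<le> arccos b"
    using b by (intro arccos_lbound) (auto simp: abs_le_iff)
  have z: "0 \<le> arccos (- (1 / 3))" "arccos (- (1 / 3)) = pi - arccos (1 / 3)"
    by (auto intro: arccos_lbound arccos_minus)
  show ?thesis
  proof (cases "- (1 / 3) \<le> p")
    case True
    have "arccos p \<le> arccos (- (1 / 3))"
      using True a by (intro arccos_le_arccos) (auto simp: abs_le_iff)
    then show ?thesis using b0 by linarith
  next
    case False
    have "arccos b \<le> arccos (1 / 3)"
      using b3 b by (intro arccos_le_arccos) (auto simp: abs_le_iff)
    then have "arccos b + arccos (- (1 / 3)) \<le> pi"
      using z by linarith
    then have "arccos (cos (arccos b + arccos (- (1 / 3)))) = arccos b + arccos (- (1 / 3))"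
      using b0 z by (intro arccos_cos) auto
    moreover have c: "cos (arccos b + arccos (- (1 / 3))) = - (b + sqrt 8 * sqrt (1 - b\<^sup>2)) / 3"
    proof -
      have "sqrt (1 - (- (1 / 3))\<^sup>2) = sqrt (8 / 9 :: real)"
        by (simp add: power2_eq_square)
      also have "\<dots> = sqrt 8 / 3"
        using real_sqrt_abs[of "3 :: real"] by (simp add: real_sqrt_divide)
      finally have "sin (arccos (- (1 / 3))) = sqrt 8 / 3"
        by (simp add: sin_arccos_abs)
      then show ?thesis
        using b by (simp add: cos_add cos_arccos_abs sin_arccos_abs field_simps)
    qed
    ultimately have "arccos b + arccos (- (1 / 3)) = arccos (- (b + sqrt 8 * sqrt (1 - b\<^sup>2)) / 3)"
      by (simp only: c)
    moreover have "arccos p \<le> arccos (- (b + sqrt 8 * sqrt (1 - b\<^sup>2)) / 3)"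
    proof (rule arccos_le_arccos)
      have "\<bar>cos (arccos b + arccos (- (1 / 3)))\<bar> \<le> 1" by simp
      then show "- 1 \<le> - (b + sqrt 8 * sqrt (1 - b\<^sup>2)) / 3"
        unfolding c by linarith
    qed (use h b3 False a in auto)
    ultimately show ?thesis by simp
  qed
qed

lemma norm_Pair_sq: "norm (y, t) = 1 \<Longrightarrow> (norm y)\<^sup>2 + t\<^sup>2 = 1" for t :: real
  by (simp add: norm_Pair)

lemma equatorial_pairsD:
  assumes "(v, y, t) \<in> equatorial_pairs"
  shows "norm v = 1" "norm (y, t) = 1" "y = norm y *\<^sub>R v" "0 \<le> t" "t \<le> 1 / 2" "t \<le> 1 / 3 \<or> axial v" "3 / 4 \<le> (norm y)\<^sup>2"
proof -
  show "norm v = 1" "norm (y, t) = 1" "y = norm y *\<^sub>R v" "0 \<le> t" "t \<le> 1 / 3 \<or> axial v"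
    using assms by (auto simp: equatorial_pairs_def)
  show t: "t \<le> 1 / 2" using assms by (auto simp: equatorial_pairs_def)
  have "t\<^sup>2 \<le> (1 / 2)\<^sup>2"
    using t \<open>0 \<le> t\<close> by (rule power_mono)
  then show "3 / 4 \<le> (norm y)\<^sup>2"
    using norm_Pair_sq[OF \<open>norm (y, t) = 1\<close>] by (simp add: power2_eq_square)
qed

lemma polar_pairsD:
  assumes "(u, y, t) \<in> polar_pairs"
  shows "norm u = 1" "norm (y, t) = 1" "1 / 3 \<le> t" "norm y / 3 \<le> y \<bullet> u" "1 / 2 \<le> t \<or> \<not> axial y"
proof -
  obtain a b where "a \<in> {1, -1}" "b \<in> {1, -1}" "u = tetra_vertex a b" "tetra_cell a b y"
    using assms unfolding polar_pairs_def by blast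
  then show "norm u = 1" "norm y / 3 \<le> y \<bullet> u"
    using norm_tetra_vertex tetra_cell_near_vertex by blast+
  show "norm (y, t) = 1" "1 / 3 \<le> t" "1 / 2 \<le> t \<or> \<not> axial y"
    using assms by (auto simp: polar_pairs_def)
qed

lemma norm_le_of_height:
  fixes y :: "'a::real_normed_vector" and t c :: real
  assumes "norm (y, t) = 1" "0 \<le> c" "c \<le> t"
  shows "(norm y)\<^sup>2 \<le> 1 - c\<^sup>2"
  using norm_Pair_sq[OF assms(1)] power_mono[OF assms(3,2), of 2] by linarith

text \<open>If both heights are below \<open>1 / 2\<close>, then neither point is axial and their projections make an angle
  of at most \<open>2 \<pi> / 3\<close>; otherwise the larger height compensates for the larger diameter of the cell.\<close>

lemma polar_same_value:
  assumes "(u, y, t) \<in> polar_pairs" "(u, y', t') \<in> polar_pairs"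
  shows "- (1 / 3) \<le> (y, t) \<bullet> (y', t')"
proof -
  obtain a b where ab: "a \<in> {1, -1}" "b \<in> {1, -1}" "u = tetra_vertex a b" "tetra_cell a b y"
    using assms(1) by (auto simp: polar_pairs_def)
  obtain a' b' where ab': "a' \<in> {1, -1}" "b' \<in> {1, -1}" "u = tetra_vertex a' b'" "tetra_cell a' b' y'"
    using assms(2) by (auto simp: polar_pairs_def)
  have "tetra_vertex a b \<bullet> tetra_vertex a' b' = 1"
    using ab ab' norm_tetra_vertex[of a b] by (simp add: dot_square_norm)
  then have "a = a'" "b = b'"
    using inner_tetra_vertex[OF ab(1,2) ab'(1,2)] by (auto split: if_splits)
  then have c: "tetra_cell a b y'" using ab' by simp
  define r where "r = norm y * norm y'"
  have r0: "0 \<le> r" by (simp add: r_def)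
  note h = polar_pairsD[OF assms(1)] polar_pairsD[OF assms(2)]
  have y: "(norm y)\<^sup>2 \<le> 8 / 9" "(norm y')\<^sup>2 \<le> 8 / 9"
    using norm_le_of_height[OF h(2), of "1/3"] norm_le_of_height[OF h(7), of "1/3"] h(3,8)
    by (simp_all add: power2_eq_square)
  have tt: "(1 / 3) * (1 / 3) \<le> t * t'"
    using h(3,8) by (intro mult_mono) auto
  show ?thesis
  proof (cases "1 / 2 \<le> t \<or> 1 / 2 \<le> t'")
    case True
    have "(norm y)\<^sup>2 * (norm y')\<^sup>2 \<le> 3 / 4 * (8 / 9)"
    proof (cases "1 / 2 \<le> t")
      case True
      then have "(norm y)\<^sup>2 \<le> 3 / 4"
        using norm_le_of_height[OF h(2), of "1/2"] by (simp add: power2_eq_square)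
      then show ?thesis using y by (intro mult_mono) auto
    next
      case False
      then have "(norm y')\<^sup>2 \<le> 3 / 4"
        using norm_le_of_height[OF h(7), of "1/2"] \<open>1 / 2 \<le> t \<or> 1 / 2 \<le> t'\<close> by (simp add: power2_eq_square)
      then have "(norm y')\<^sup>2 * (norm y)\<^sup>2 \<le> 3 / 4 * (8 / 9)" using y by (intro mult_mono) auto
      then show ?thesis by (simp add: mult.commute)
    qed
    then have "r\<^sup>2 \<le> (5 / 6)\<^sup>2"
      unfolding r_def power_mult_distrib by (rule order_trans) (simp add: power2_eq_square)
    then have "r \<le> 5 / 6" by (rule power2_le_imp_le) simp
    moreover have "(1 / 2) * (1 / 3) \<le> t * t'"
    proof (cases "1 / 2 \<le> t")
      case True then show ?thesis using h(8) by (intro mult_mono) auto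
    next
      case False
      then have "(1 / 3) * (1 / 2) \<le> t * t'" using True h(3) by (intro mult_mono) auto
      then show ?thesis by simp
    qed
    moreover have "- (3 / 5) * r \<le> y \<bullet> y'"
      using tetra_cell_inner(1)[OF ab(1,2,4) c] by (simp add: r_def)
    ultimately show ?thesis by simp
  next
    case False
    have "(norm y)\<^sup>2 * (norm y')\<^sup>2 \<le> 8 / 9 * (8 / 9)"
      using y by (intro mult_mono) auto
    then have "r\<^sup>2 \<le> (8 / 9)\<^sup>2"
      unfolding r_def power_mult_distrib by (rule order_trans) (simp add: power2_eq_square)
    then have "r \<le> 8 / 9" by (rule power2_le_imp_le) simp
    moreover have "- (1 / 2) * r \<le> y \<bullet> y'"
      using tetra_cell_inner(2)[OF ab(1,2,4) c] h(5,10) False by (simp add: r_def)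
    ultimately show ?thesis using tt by simp
  qed
qed

lemma polar_values:
  assumes "(u, y, t) \<in> polar_pairs" "(u', y', t') \<in> polar_pairs"
  shows "u = u' \<or> u \<bullet> u' = - (1 / 3)"
  using assms inner_tetra_vertex by (auto simp: polar_pairs_def)

definition upper_pairs :: "((real \<times> real \<times> real) \<times> (real \<times> real \<times> real) \<times> real) set" where
  "upper_pairs = equatorial_pairs \<union> polar_pairs"

text \<open>The hypothesis of \<open>arccos_le_add_obtuse\<close>: the angle with cosine \<open>p\<close> exceeds the one
  with cosine \<open>b\<close> by at most \<open>arccos (- (1 / 3))\<close>.\<close>

definition within_obtuse :: "real \<Rightarrow> real \<Rightarrow> bool" where
  "within_obtuse b p \<longleftrightarrow> b \<le> 1 / 3 \<or> - (1 / 3) \<le> p \<or> - (b + sqrt 8 * sqrt (1 - b\<^sup>2)) / 3 \<le> p"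

text \<open>The points are within \<open>\<pi> / 6\<close> of their projections, so the two angles differ by at most
  \<open>\<pi> / 3\<close>.\<close>

lemma equatorial_equatorial:
  assumes "(v, y, t) \<in> equatorial_pairs" "(v', y', t') \<in> equatorial_pairs"
  shows "within_obtuse (v \<bullet> v') ((y, t) \<bullet> (y', t'))" "within_obtuse (- (v \<bullet> v')) (- ((y, t) \<bullet> (y', t')))"
proof -
  note h = equatorial_pairsD[OF assms(1)] equatorial_pairsD[OF assms(2)]
  define r where "r = norm y * norm y'"
  have yy: "y \<bullet> y' = r * (v \<bullet> v')"
    by (subst h(3), subst h(10)) (simp add: r_def)
  have r0: "0 \<le> r" by (simp add: r_def)
  have tt: "0 \<le> t * t'" "t * t' \<le> (1 / 2) * (1 / 2)"
    using h(4,5,11,12) by (simp, intro mult_mono) auto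
  show "within_obtuse (v \<bullet> v') ((y, t) \<bullet> (y', t'))"
  proof (cases "v \<bullet> v' \<le> 1 / 3")
    case False
    then have "0 \<le> r * (v \<bullet> v')" using r0 by simp
    then show ?thesis using tt by (simp add: within_obtuse_def yy)
  qed (simp add: within_obtuse_def)
  show "within_obtuse (- (v \<bullet> v')) (- ((y, t) \<bullet> (y', t')))"
  proof (cases "- (v \<bullet> v') \<le> 1 / 3")
    case False
    have "0 \<le> r * (- (v \<bullet> v'))" using False r0 by (intro mult_nonneg_nonneg) auto
    then show ?thesis using tt by (simp add: within_obtuse_def yy)
  qed (simp add: within_obtuse_def)
qed

text \<open>On the same side of the equator, the triangle inequality through \<open>u\<close> suffices. On opposite sides the
  heights pull the points apart, which is the situation of \<open>opposite_hemisphere_bound\<close>.\<close>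

lemma equatorial_polar:
  assumes l: "(v, y, t) \<in> equatorial_pairs" and hi: "(u, y', t') \<in> polar_pairs"
  shows "within_obtuse (v \<bullet> u) ((y, t) \<bullet> (y', t'))" "within_obtuse (- (v \<bullet> u)) (- ((y, t) \<bullet> (y', t')))"
proof -
  note l = equatorial_pairsD[OF l] and h = polar_pairsD[OF hi]
  have inner: "(y, t) \<bullet> (y', t') = norm y * (v \<bullet> y') + t * t'"
    by (subst l(3)) simp
  have le1: "norm y \<le> 1" "norm y' \<le> 1"
    using l(2) h(2) norm_fst_le[of y t] norm_fst_le[of y' t'] by auto
  have tt: "0 \<le> t * t'" using l(4) h(3) by simp
  show "within_obtuse (v \<bullet> u) ((y, t) \<bullet> (y', t'))"
  proof (cases "v \<bullet> u \<le> 1 / 3 \<or> 0 \<le> v \<bullet> y'")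
    case True
    moreover have "- (1 / 3) \<le> (y, t) \<bullet> (y', t')" if "0 \<le> v \<bullet> y'"
      using mult_nonneg_nonneg[OF norm_ge_zero[of y] that] tt unfolding inner by linarith
    ultimately show ?thesis by (auto simp only: within_obtuse_def)
  next
    case False
    define k where "k = sqrt 8 * sqrt (1 - (v \<bullet> u)\<^sup>2)"
    have e: "norm y' * ((v \<bullet> u - k) / 3) \<le> v \<bullet> y'"
      using inner_tangent_bound[OF l(1) h(1) _ h(4)] False by (simp add: k_def)
    then have "(v \<bullet> u - k) / 3 < 0"
      using False by (smt (verit) mult_nonneg_nonneg norm_ge_zero)
    then have "1 * ((v \<bullet> u - k) / 3) \<le> norm y' * ((v \<bullet> u - k) / 3)"
      using le1 by (intro mult_right_mono_neg) auto
    moreover have "1 * (v \<bullet> y') \<le> norm y * (v \<bullet> y')"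
      using le1 False by (intro mult_right_mono_neg) auto
    ultimately have "(v \<bullet> u - k) / 3 \<le> (y, t) \<bullet> (y', t')"
      using e tt inner by linarith
    moreover have "- (v \<bullet> u + k) / 3 = (v \<bullet> u - k) / 3 - 2 / 3 * (v \<bullet> u)"
      by (simp add: field_simps)
    ultimately have "- (v \<bullet> u + k) / 3 \<le> (y, t) \<bullet> (y', t')"
      using False by linarith
    then show ?thesis by (simp add: within_obtuse_def k_def)
  qed
  show "within_obtuse (- (v \<bullet> u)) (- ((y, t) \<bullet> (y', t')))"
  proof (cases "- (v \<bullet> u) \<le> 1 / 3")
    case False
    define w where "w = - v"
    have w: "norm w = 1" "1 / 3 \<le> w \<bullet> u" "w \<bullet> u \<le> 1"
      using l(1) False abs_inner_le_1[OF l(1) h(1)] by (auto simp: w_def)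
    have "t \<le> 1 / 3 \<or> t \<le> 1 / 2 \<and> w \<bullet> u \<le> 98 / 100"
      using l(5,6) axial_inner_tetra_vertex[of w] w(1) hi by (auto simp: polar_pairs_def w_def axial_minus)
    moreover have "norm y' * (w \<bullet> u - sqrt 8 * sqrt (1 - (w \<bullet> u)\<^sup>2)) / 3 \<le> w \<bullet> y'"
      using inner_tangent_bound[OF w(1) h(1) _ h(4)] w by simp
    ultimately have "- (w \<bullet> u + sqrt 8 * sqrt (1 - (w \<bullet> u)\<^sup>2)) / 3 \<le> norm y * (w \<bullet> y') - t * t'"
      using w l(4) h(3) norm_Pair_sq[OF l(2)] norm_Pair_sq[OF h(2)]
      by (intro opposite_hemisphere_bound) auto
    moreover have "norm y * (w \<bullet> y') - t * t' = - ((y, t) \<bullet> (y', t'))"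
      unfolding inner w_def by (simp only: inner_minus_left mult_minus_right minus_add_distrib diff_conv_add_uminus)
    moreover have "w \<bullet> u = - (v \<bullet> u)" by (simp add: w_def)
    ultimately show ?thesis unfolding within_obtuse_def by simp
  qed (simp add: within_obtuse_def)
qed

text \<open>Different vertices make the angle \<open>arccos (- (1 / 3))\<close>, and a vertex makes its supplement with the
  antipode of another one; for these values nothing is required of the points. For equal vertices the claim is
  \<open>polar_same_value\<close>.\<close>

lemma polar_polar:
  assumes "(u, y, t) \<in> polar_pairs" "(u', y', t') \<in> polar_pairs"
  shows "within_obtuse (u \<bullet> u') ((y, t) \<bullet> (y', t'))" "within_obtuse (- (u \<bullet> u')) (- ((y, t) \<bullet> (y', t')))"
proof -
  have "u \<bullet> u' = 1" if "u = u'"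
    using that polar_pairsD(1)[OF assms(1)] by (simp add: dot_square_norm)
  then show "within_obtuse (u \<bullet> u') ((y, t) \<bullet> (y', t'))" "within_obtuse (- (u \<bullet> u')) (- ((y, t) \<bullet> (y', t')))"
    using polar_values[OF assms] polar_same_value[of u y t y' t'] assms by (auto simp: within_obtuse_def)
qed

lemma upper_upper:
  assumes "(u, p) \<in> upper_pairs" "(u', p') \<in> upper_pairs"
  shows "within_obtuse (u \<bullet> u') (p \<bullet> p')" "within_obtuse (- (u \<bullet> u')) (- (p \<bullet> p'))"
proof -
  obtain y t y' t' where p: "p = (y, t)" "p' = (y', t')" by (cases p, cases p')
  consider "(u, p) \<in> equatorial_pairs" "(u', p') \<in> equatorial_pairs" | "(u, p) \<in> equatorial_pairs" "(u', p') \<in> polar_pairs"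
    | "(u, p) \<in> polar_pairs" "(u', p') \<in> equatorial_pairs" | "(u, p) \<in> polar_pairs" "(u', p') \<in> polar_pairs"
    using assms by (auto simp: upper_pairs_def)
  then have "within_obtuse (u \<bullet> u') (p \<bullet> p') \<and> within_obtuse (- (u \<bullet> u')) (- (p \<bullet> p'))"
  proof cases
    case 1 then show ?thesis using equatorial_equatorial unfolding p by blast
  next
    case 2 then show ?thesis using equatorial_polar unfolding p by blast
  next
    case 3 then show ?thesis
      using equatorial_polar[of u' y' t' u y t] unfolding p by (simp only: inner_commute[of u u'] inner_commute[of "(y, t)" "(y', t')"])
  next
    case 4 then show ?thesis using polar_polar unfolding p by blast
  qed
  then show "within_obtuse (u \<bullet> u') (p \<bullet> p')" "within_obtuse (- (u \<bullet> u')) (- (p \<bullet> p'))" by blast+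
qed

definition tetra_correspondence :: "((real \<times> real \<times> real) \<times> (real \<times> real \<times> real) \<times> real) set" where
  "tetra_correspondence = upper_pairs \<union> uminus ` upper_pairs"

lemma tetra_correspondence_iff:
  "(u, p) \<in> tetra_correspondence \<longleftrightarrow> (u, p) \<in> upper_pairs \<or> (- u, - p) \<in> upper_pairs"
proof -
  have "(u, p) \<in> uminus ` upper_pairs \<longleftrightarrow> - (u, p) \<in> upper_pairs"
    by (metis (no_types, lifting) image_iff minus_minus)
  then show ?thesis
    by (simp add: tetra_correspondence_def)
qed

lemma upper_pairs_cover:
  assumes p: "norm (y, t) = 1" "0 \<le> t" shows "\<exists>u. (u, y, t) \<in> upper_pairs"
proof (cases "1 / 2 \<le> t \<or> 1 / 3 \<le> t \<and> \<not> axial y")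
  case True
  obtain a b where "a \<in> {1, -1}" "b \<in> {1, -1}" "tetra_cell a b y"
    using ex_tetra_cell by blast
  then have "(tetra_vertex a b, y, t) \<in> polar_pairs"
    using p True unfolding polar_pairs_def by blast
  then show ?thesis unfolding upper_pairs_def by blast
next
  case False
  then have t: "t < 1 / 2" by auto
  have "y \<noteq> 0"
    using p t by (auto simp: norm_Pair power2_eq_1_iff)
  then have "axial (y /\<^sub>R norm y) = axial y"
    by (intro axial_scaleR) simp
  then have "(y /\<^sub>R norm y, y, t) \<in> equatorial_pairs"
    using p False \<open>y \<noteq> 0\<close> by (auto simp: equatorial_pairs_def)
  then show ?thesis unfolding upper_pairs_def by blast
qed

lemma equator_in_upper_pairs: "norm v = 1 \<Longrightarrow> (v, v, 0) \<in> upper_pairs"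
  by (simp add: upper_pairs_def equatorial_pairs_def norm_Pair)

lemma Z2_correspondence_tetra:
  "Z2_correspondence (sphere 0 1) uminus (sphere 0 1) uminus tetra_correspondence"
  unfolding Z2_correspondence_def
proof (intro conjI)
  have upper_pairs: "upper_pairs \<subseteq> sphere 0 1 \<times> sphere 0 1"
  proof clarify
    fix u y and t :: real
    assume "(u, y, t) \<in> upper_pairs"
    then have "norm u = 1 \<and> norm (y, t) = 1"
      unfolding upper_pairs_def using equatorial_pairsD(1,2) polar_pairsD(1,2) by blast
    then show "u \<in> sphere 0 1 \<and> (y, t) \<in> sphere 0 1" by simp
  qed
  have iff: "(u, p) \<in> tetra_correspondence \<longleftrightarrow> (u, p) \<in> upper_pairs \<or> (- u, - p) \<in> upper_pairs" for u p
    by (rule tetra_correspondence_iff)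
  show sub: "tetra_correspondence \<subseteq> sphere 0 1 \<times> sphere 0 1"
  proof (intro subsetI)
    fix q assume "q \<in> tetra_correspondence"
    then consider "q \<in> upper_pairs" | "- q \<in> upper_pairs"
      unfolding tetra_correspondence_def by auto
    then show "q \<in> sphere 0 1 \<times> sphere 0 1"
    proof cases
      case 1 from subsetD[OF upper_pairs this] show ?thesis .
    next
      case 2 from subsetD[OF upper_pairs this] show ?thesis by (simp add: mem_Times_iff)
    qed
  qed
  have "v \<in> fst ` tetra_correspondence" if "v \<in> sphere 0 1" for v
  proof (rule image_eqI)
    show "v = fst (v, v, 0 :: real)" by simp
    show "(v, v, 0) \<in> tetra_correspondence"
      using equator_in_upper_pairs[of v] that by (simp add: tetra_correspondence_def)
  qed
  then show "fst ` tetra_correspondence = sphere 0 1"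
    using sub by (intro equalityI subsetI) (auto simp: subset_iff)
  have cov: "\<exists>u. (u, q) \<in> upper_pairs" if "norm q = 1" "0 \<le> snd q" for q
    using upper_pairs_cover[of "fst q" "snd q"] that by simp
  have "p \<in> snd ` tetra_correspondence" if p: "p \<in> sphere 0 1" for p
  proof -
    have "\<exists>u. (u, p) \<in> tetra_correspondence"
    proof (cases "0 \<le> snd p")
      case True
      then show ?thesis
        using cov[of p] p by (auto simp: iff)
    next
      case False
      then obtain u where "(u, - p) \<in> upper_pairs"
        using cov[of "- p"] p by auto
      then have "(- u, p) \<in> tetra_correspondence"
        by (simp add: iff)
      then show ?thesis by blast
    qed
    then show ?thesis by (metis image_eqI snd_conv)
  qed
  then show "snd ` tetra_correspondence = sphere 0 1"
    using sub by (intro equalityI subsetI) (auto simp: subset_iff)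
  show "\<forall>(x, y)\<in>tetra_correspondence. (- x, - y) \<in> tetra_correspondence"
    using iff by (simp add: Ball_def)
qed

lemma tetra_correspondence_angle:
  assumes "(u, p) \<in> tetra_correspondence" "(u', p') \<in> tetra_correspondence"
  shows "arccos (p \<bullet> p') \<le> arccos (u \<bullet> u') + arccos (- (1 / 3))"
proof (rule arccos_le_add_obtuse)
  have n: "u \<in> sphere 0 1" "p \<in> sphere 0 1" "u' \<in> sphere 0 1" "p' \<in> sphere 0 1"
    using assms Z2_correspondence_tetra unfolding Z2_correspondence_def by (blast dest: subsetD)+
  then show "\<bar>p \<bullet> p'\<bar> \<le> 1" "\<bar>u \<bullet> u'\<bar> \<le> 1"
    by (simp_all add: abs_inner_le_1)
  have "within_obtuse (u \<bullet> u') (p \<bullet> p')"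
  proof -
    note split = tetra_correspondence_iff[THEN iffD1]
    show ?thesis
      using split[OF assms(1)] split[OF assms(2)] upper_upper[of u p u' p'] upper_upper[of u p "- u'" "- p'"]
        upper_upper[of "- u" "- p" u' p'] upper_upper[of "- u" "- p" "- u'" "- p'"]
      by (auto simp only: inner_minus_left inner_minus_right minus_minus)
  qed
  then show "u \<bullet> u' \<le> 1 / 3 \<or> - (1 / 3) \<le> p \<bullet> p' \<or> - (u \<bullet> u' + sqrt 8 * sqrt (1 - (u \<bullet> u')\<^sup>2)) / 3 \<le> p \<bullet> p'"
    by (simp add: within_obtuse_def)
qed

lemma dGH_Z2_S2_S3: "dGH_Z2 (sphere (0::real \<times> real \<times> real) 1) uminus
   (sphere (0::(real \<times> real \<times> real) \<times> real) 1) uminus \<le> ennreal (sqrt (2 / 3))"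
proof -
  define \<zeta> where "\<zeta> = arccos (- (1 / 3))"
  have \<zeta>: "0 \<le> \<zeta>" "\<zeta> \<le> pi"
    unfolding \<zeta>_def by (intro arccos_lbound arccos_ubound; simp)+
  have "cos \<zeta> = - (1 / 3)"
    unfolding \<zeta>_def by (rule cos_arccos) auto
  then have "(sin (\<zeta> / 2))\<^sup>2 = 2 / 3"
    using cos_double_sin[of "\<zeta> / 2"] by simp
  moreover have "0 \<le> sin (\<zeta> / 2)"
    using \<zeta> by (intro sin_ge_zero) auto
  ultimately have "sin (\<zeta> / 2) = sqrt (2 / 3)"
    by (metis real_sqrt_unique)
  then show ?thesis
    using dGH_Z2_sphere_le[OF Z2_correspondence_tetra, of \<zeta>] tetra_correspondence_angle \<zeta> by (simp add: \<zeta>_def)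
qed

section \<open>The three distances\<close>

theorem corollary7p2:
  shows "dGH_Z2 (sphere (0::real^2) 1) uminus (sphere (0::real^3) 1) uminus = ennreal (sqrt 3 / 2) \<and>
         dGH_Z2 (sphere (0::real^2) 1) uminus (sphere (0::real^4) 1) uminus = ennreal (sqrt 3 / 2) \<and>
         dGH_Z2 (sphere (0::real^3) 1) uminus (sphere (0::real^4) 1) uminus = ennreal (sqrt (2 / 3))"
proof (intro conjI antisym)
  have "sqrt (8 / 3) / 2 = sqrt (2 / 3)"
    by (simp add: real_sqrt_divide real_sqrt_mult[of 4 2, simplified])
  then show "ennreal (sqrt (2 / 3)) \<le> dGH_Z2 (sphere (0::real^3) 1) uminus (sphere (0::real^4) 1) uminus"
    using dGH_Z2_spheres_lower_bound[where 'a="real^3" and 'b="real^4"] by simp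
  show "ennreal (sqrt 3 / 2) \<le> dGH_Z2 (sphere (0::real^2) 1) uminus (sphere (0::real^3) 1) uminus"
    using dGH_Z2_spheres_lower_bound[where 'a="real^2" and 'b="real^3"] by simp
  show "ennreal (sqrt 3 / 2) \<le> dGH_Z2 (sphere (0::real^2) 1) uminus (sphere (0::real^4) 1) uminus"
    using dGH_Z2_spheres_lower_bound[where 'a="real^2" and 'b="real^4"] by simp
  have "dGH_Z2 (sphere (0::real^2) 1) uminus (sphere (0::real^3) 1) uminus
      \<le> dGH_Z2 (sphere (0::complex) 1) uminus (sphere (0::complex \<times> real) 1) uminus"
    by (rule dGH_Z2_sphere_mono_type) auto
  also note dGH_Z2_S1_S2
  finally show "dGH_Z2 (sphere (0::real^2) 1) uminus (sphere (0::real^3) 1) uminus \<le> ennreal (sqrt 3 / 2)" .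
  have "dGH_Z2 (sphere (0::real^2) 1) uminus (sphere (0::real^4) 1) uminus
      \<le> dGH_Z2 (sphere (0::complex) 1) uminus (sphere (0::complex \<times> complex) 1) uminus"
    by (rule dGH_Z2_sphere_mono_type) auto
  also note dGH_Z2_S1_S3
  finally show "dGH_Z2 (sphere (0::real^2) 1) uminus (sphere (0::real^4) 1) uminus \<le> ennreal (sqrt 3 / 2)" .
  have "dGH_Z2 (sphere (0::real^3) 1) uminus (sphere (0::real^4) 1) uminus
      \<le> dGH_Z2 (sphere (0::real \<times> real \<times> real) 1) uminus (sphere (0::(real \<times> real \<times> real) \<times> real) 1) uminus"
    by (rule dGH_Z2_sphere_mono_type) auto
  also note dGH_Z2_S2_S3
  finally show "dGH_Z2 (sphere (0::real^3) 1) uminus (sphere (0::real^4) 1) uminus \<le> ennreal (sqrt (2 / 3))" .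
qed

end
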